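(* Let $I=[a,b]\subset\mathbb{R}$ be a closed bounded interval ($a<b$) and let $\varphi\in\Phi_{\mathrm w}(I)$ satisfy (A0) and (A1). Then there is a constant $c>0$ such that the following holds: if $f:I\to\mathbb{R}$ is absolutely continuous and $f'\in L^\varphi(I)$, then $f\in\mathrm{RBV}^\varphi(I)$ and $$\|f\|_{\mathrm{RBV}^\varphi(I)}\le c\,\|f'\|_{L^\varphi(I)}.$$
   Context: $\Phi_{\mathrm w}(I)$ is the set of functions $\varphi:I\times[0,\infty)\to[0,\infty]$ such that: $x\mapsto\varphi(x,|g(x)|)$ is measurable for every measurable $g:I\to\mathbb{R}$; for every $x\in I$, $t\mapsto\varphi(x,t)$ is non-decreasing with $\varphi(x,0)=\lim_{t\to0^+}\varphi(x,t)=0$ and $\lim_{t\to\infty}\varphi(x,t)=\infty$; and there is $L\ge1$, independent of $x$, with $\frac{\varphi(x,s)}{s}\le L\frac{\varphi(x,t)}{t}$ for all $0<s<t$ and $x\in I$. (A0): there is $\beta\in(0,1]$ with $\varphi(x,\beta)\le1\le\varphi(x,\frac1\beta)$ for all $x\in I$. (A1): for every $K>0$ there is $\beta\in(0,1]$ such that for every ball $B\subset\mathbb{R}$ and all $x,y\in B\cap I$, $\varphi(x,\beta t)\le\varphi(y,t)+1$ whenever $\varphi(y,t)\in[0,\frac{K}{|B|}]$. For measurable $g$, $\varrho_\varphi(g):=\int_I\varphi(x,|g(x)|)\,dx$; $L^\varphi(I)$ is the set of measurable $g$ with $\lim_{\lambda\to0^+}\varrho_\varphi(\lambda g)=0$,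 and $\|g\|_{L^\varphi(I)}:=\inf\{\lambda>0\mid\varrho_\varphi(g/\lambda)\le1\}$. For $A\subset I$ let $\varphi^+_A(t):=\sup_{x\in A}\varphi(x,t)$. A partition $(I_k)_{k=1}^n$ of $I$ is a finite family of non-degenerate closed intervals with disjoint interiors and union $I$. For $I_k=[a_k,b_k]$, $\Delta_kf:=f(a_k)-f(b_k)$. Define $$\mathrm V^\varphi_I(f):=\sup_{(I_k)}\sum_{k=1}^n\varphi^+_{I_k}\Big(\frac{|\Delta_kf|}{|I_k|}\Big)|I_k|$$ (supremum over all partitions), $\mathrm{RBV}^\varphi(I):=\{f:I\to\mathbb{R}\mid\lim_{\lambda\to0}\mathrm V^\varphi_I(\lambda f)=0\}$ and $\|f\|_{\mathrm{RBV}^\varphi(I)}:=\inf\{\lambda>0\mid\mathrm V^\varphi_I(f/\lambda)\le1\}$. *)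

theory Defs
  imports "HOL-Analysis.Analysis"
begin

text \<open>
  A generalised weak Phi-function on \<open>I\<close> is a function \<open>real \<Rightarrow> real \<Rightarrow> ennreal\<close> of which only the
  values at \<open>x \<in> I\<close> and \<open>t \<ge> 0\<close> are ever used.  Likewise, functions on \<open>I\<close> are total functions
  on \<open>real\<close> of which only the restriction to \<open>I\<close> matters.  Measurability is Lebesgue measurability.
  The derivative of an absolutely continuous function is rendered by \<open>deriv f\<close>: it is the
  derivative at almost every point of the interval, and its values on the remaining null set
  affect neither measurability nor the modular.
\<close>

definition Phi_w :: "real set \<Rightarrow> (real \<Rightarrow> real \<Rightarrow> ennreal) set" where
  "Phi_w I = {\<phi>.
     (\<forall>g::real \<Rightarrow> real. g \<in> borel_measurable (lebesgue_on I) \<longrightarrow>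
        (\<lambda>x. \<phi> x \<bar>g x\<bar>) \<in> borel_measurable (lebesgue_on I)) \<and>
     (\<forall>x\<in>I. mono_on {0..} (\<phi> x) \<and> \<phi> x 0 = 0 \<and>
        (\<phi> x \<longlongrightarrow> 0) (at_right 0) \<and> (\<phi> x \<longlongrightarrow> \<infinity>) at_top) \<and>
     (\<exists>L::real. L \<ge> 1 \<and> (\<forall>x\<in>I. \<forall>s t. 0 < s \<and> s < t \<longrightarrow>
        \<phi> x s / ennreal s \<le> ennreal L * (\<phi> x t / ennreal t)))}"

definition A0 :: "real set \<Rightarrow> (real \<Rightarrow> real \<Rightarrow> ennreal) \<Rightarrow> bool" where
  "A0 I \<phi> \<longleftrightarrow> (\<exists>\<beta>::real. 0 < \<beta> \<and> \<beta> \<le> 1 \<and> (\<forall>x\<in>I. \<phi> x \<beta> \<le> 1 \<and> 1 \<le> \<phi> x (1 / \<beta>)))"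

definition A1 :: "real set \<Rightarrow> (real \<Rightarrow> real \<Rightarrow> ennreal) \<Rightarrow> bool" where
  "A1 I \<phi> \<longleftrightarrow> (\<forall>K::real. K > 0 \<longrightarrow> (\<exists>\<beta>::real. 0 < \<beta> \<and> \<beta> \<le> 1 \<and>
     (\<forall>z r. r > 0 \<longrightarrow> (\<forall>x \<in> ball z r \<inter> I. \<forall>y \<in> ball z r \<inter> I. \<forall>t\<ge>0.
        \<phi> y t \<le> ennreal (K / measure lebesgue (ball z r)) \<longrightarrow> \<phi> x (\<beta> * t) \<le> \<phi> y t + 1))))"

definition modular :: "real set \<Rightarrow> (real \<Rightarrow> real \<Rightarrow> ennreal) \<Rightarrow> (real \<Rightarrow> real) \<Rightarrow> ennreal" where
  "modular I \<phi> g = (\<integral>\<^sup>+ x. \<phi> x \<bar>g x\<bar> \<partial>lebesgue_on I)"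

definition L_phi :: "real set \<Rightarrow> (real \<Rightarrow> real \<Rightarrow> ennreal) \<Rightarrow> (real \<Rightarrow> real) set" where
  "L_phi I \<phi> = {g. g \<in> borel_measurable (lebesgue_on I) \<and>
     ((\<lambda>l. modular I \<phi> (\<lambda>x. l * g x)) \<longlongrightarrow> 0) (at_right 0)}"

text \<open>The Luxemburg norms are \<open>ennreal\<close>-valued, so that the infimum of the empty set is \<open>\<infinity>\<close>.\<close>

definition L_phi_norm :: "real set \<Rightarrow> (real \<Rightarrow> real \<Rightarrow> ennreal) \<Rightarrow> (real \<Rightarrow> real) \<Rightarrow> ennreal" where
  "L_phi_norm I \<phi> g = (INF l \<in> {l::real. l > 0 \<and> modular I \<phi> (\<lambda>x. g x / l) \<le> 1}. ennreal l)"

definition phi_plus :: "(real \<Rightarrow> real \<Rightarrow> ennreal) \<Rightarrow> real set \<Rightarrow> real \<Rightarrow> ennreal" where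
  "phi_plus \<phi> A t = (SUP x\<in>A. \<phi> x t)"

text \<open>
  A partition is given by the set of its members: non-degenerate intervals with disjoint interiors
  are pairwise distinct, so an indexed family carries no more information.  For \<open>division_of\<close>,
  the members are non-empty compact intervals.
\<close>

definition partition_of :: "real set set \<Rightarrow> real set \<Rightarrow> bool" (infixl "partition'_of" 40) where
  "P partition_of I \<longleftrightarrow> P division_of I \<and> (\<forall>J\<in>P. Inf J < Sup J)"

definition Delta :: "(real \<Rightarrow> real) \<Rightarrow> real set \<Rightarrow> real" where
  "Delta f J = f (Inf J) - f (Sup J)"

definition Var_phi :: "real set \<Rightarrow> (real \<Rightarrow> real \<Rightarrow> ennreal) \<Rightarrow> (real \<Rightarrow> real) \<Rightarrow> ennreal" where
  "Var_phi I \<phi> f = (SUP P \<in> {P. P partition_of I}.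
     \<Sum>J\<in>P. phi_plus \<phi> J (\<bar>Delta f J\<bar> / measure lebesgue J) * ennreal (measure lebesgue J))"

definition RBV :: "real set \<Rightarrow> (real \<Rightarrow> real \<Rightarrow> ennreal) \<Rightarrow> (real \<Rightarrow> real) set" where
  "RBV I \<phi> = {f. ((\<lambda>l. Var_phi I \<phi> (\<lambda>x. l * f x)) \<longlongrightarrow> 0) (at 0)}"

definition RBV_norm :: "real set \<Rightarrow> (real \<Rightarrow> real \<Rightarrow> ennreal) \<Rightarrow> (real \<Rightarrow> real) \<Rightarrow> ennreal" where
  "RBV_norm I \<phi> f = (INF l \<in> {l::real. l > 0 \<and> Var_phi I \<phi> (\<lambda>x. f x / l) \<le> 1}. ennreal l)"

definition abs_continuous_on :: "real set \<Rightarrow> (real \<Rightarrow> real) \<Rightarrow> bool" where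
  "abs_continuous_on I f \<longleftrightarrow> (\<forall>\<epsilon>>0. \<exists>\<delta>>0. \<forall>(n::nat) (u::nat \<Rightarrow> real) (v::nat \<Rightarrow> real).
     (\<forall>i<n. u i < v i \<and> {u i..v i} \<subseteq> I) \<and>
     disjoint_family_on (\<lambda>i. {u i<..<v i}) {..<n} \<and>
     (\<Sum>i<n. v i - u i) < \<delta>
     \<longrightarrow> (\<Sum>i<n. \<bar>f (v i) - f (u i)\<bar>) < \<epsilon>)"

end

theory Submission
  imports Defs
begin

text \<open>
  On an interval \<open>J\<close> of a partition let \<open>T\<close> be the slope \<open>\<bar>\<Delta>f\<bar> / \<bar>J\<bar>\<close>, which is at most the mean of
  \<open>\<bar>f'\<bar>\<close> over \<open>J\<close>. Since \<open>\<phi>(x,t)/t\<close> is almost increasing, a weak form of Jensen's inequality gives a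
  point \<open>y \<in> J\<close> at which \<open>\<phi>(y,T/2)\<close> is at most, up to a small error, \<open>L\<close> times the mean of \<open>\<phi>(\<cdot>,\<bar>f'\<bar>)\<close>
  over \<open>J\<close>. If the modular of \<open>f'\<close> is at most 1, this is of order \<open>1/\<bar>J\<bar>\<close>, so (A1) carries the bound from
  \<open>y\<close> to every \<open>x \<in> J\<close> at the cost of an additive constant. Summation over the partition yields
  that the variation of \<open>\<beta> f / 2\<close> is at most \<open>L + 2 (b - a)\<close>, and a further scaling brings it below 1.

  The bound \<open>\<bar>f(d) - f(c)\<bar> \<le> \<integral>\<bar>f'\<bar>\<close> needs differentiability almost everywhere. The
  variations of \<open>f\<close> along dyadic grids increase to a monotone absolutely continuous \<open>V\<close> such that \<open>V + f\<close> is
  monotone too; the Stieltjes measures of both have Lebesgue densities by Radon-Nikodym, so \<open>f\<close> is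
  an indefinite integral.
\<close>

subsection \<open>Absolutely continuous monotone functions\<close>

text \<open>A bijection with an initial segment of the naturals frees the definition from its
  numbering of the intervals. Later families are indexed by \<open>unit\<close>, by the cells of a
  covering and by the cell numbers of a grid.\<close>

lemma abs_continuous_onD:
  fixes f :: "real \<Rightarrow> real" and \<epsilon> :: real
  assumes "abs_continuous_on I f" "\<epsilon> > 0"
  shows "\<exists>\<delta>>0. \<forall>(A :: 'i set) u v. finite A \<longrightarrow> (\<forall>i\<in>A. u i < v i \<and> {u i..v i} \<subseteq> I) \<longrightarrow>
          disjoint_family_on (\<lambda>i. {u i<..<v i}) A \<longrightarrow> (\<Sum>i\<in>A. v i - u i) < \<delta> \<longrightarrow>
          (\<Sum>i\<in>A. \<bar>f (v i) - f (u i)\<bar>) < \<epsilon>"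
proof -
  obtain \<delta> where "\<delta> > 0" and \<delta>: "\<forall>(n::nat) u v. (\<forall>i<n. u i < v i \<and> {u i..v i} \<subseteq> I) \<and>
      disjoint_family_on (\<lambda>i. {u i<..<v i}) {..<n} \<and> (\<Sum>i<n. v i - u i) < \<delta>
      \<longrightarrow> (\<Sum>i<n. \<bar>f (v i) - f (u i)\<bar>) < \<epsilon>"
    using assms unfolding abs_continuous_on_def by blast
  show ?thesis
  proof (intro exI[of _ \<delta>] conjI allI impI)
    fix A :: "'i set" and u v
    assume "finite A" and uv: "\<forall>i\<in>A. u i < v i \<and> {u i..v i} \<subseteq> I"
      and disj: "disjoint_family_on (\<lambda>i. {u i<..<v i}) A" and less: "(\<Sum>i\<in>A. v i - u i) < \<delta>"
  obtain h where h: "bij_betw h {..<card A} A"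
      using ex_bij_betw_nat_finite[OF \<open>finite A\<close>] by (auto simp: atLeast0LessThan)
    have re: "(\<Sum>i\<in>A. w i) = (\<Sum>i<card A. w (h i))" for w :: "'i \<Rightarrow> real"
      using sum.reindex_bij_betw[OF h] by metis
    have "(\<Sum>i<card A. \<bar>f (v (h i)) - f (u (h i))\<bar>) < \<epsilon>"
    proof (rule \<delta>[rule_format], intro conjI allI impI)
      fix i assume "i < card A"
      then have "h i \<in> A" using h by (auto simp: bij_betw_def)
      then show "u (h i) < v (h i)" "{u (h i)..v (h i)} \<subseteq> I"
        using uv by auto
    next
      show "disjoint_family_on (\<lambda>i. {u (h i)<..<v (h i)}) {..<card A}"
        unfolding disjoint_family_on_def
      proof (intro ballI impI)
        fix i j assume ij: "i \<in> {..<card A}" "j \<in> {..<card A}" "i \<noteq> j"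
        then have "h i \<in> A" "h j \<in> A" "h i \<noteq> h j"
          using h by (auto simp: bij_betw_def inj_on_def)
        then show "{u (h i)<..<v (h i)} \<inter> {u (h j)<..<v (h j)} = {}"
          using disj by (auto simp: disjoint_family_on_def)
      qed
      show "(\<Sum>i<card A. v (h i) - u (h i)) < \<delta>"
        using less unfolding re .
    qed
    then show "(\<Sum>i\<in>A. \<bar>f (v i) - f (u i)\<bar>) < \<epsilon>"
      unfolding re .
  qed fact
qed

lemma abs_continuous_on_imp_continuous_on:
  assumes ac: "abs_continuous_on I f" and I: "is_interval I"
  shows "continuous_on I f"
proof (unfold continuous_on_iff, intro ballI allI impI)
  fix x e :: real assume x: "x \<in> I" and "e > 0"
  obtain \<delta> where "\<delta> > 0" and \<delta>: "\<forall>(A :: unit set) u v. finite A \<longrightarrow> (\<forall>i\<in>A. u i < v i \<and> {u i..v i} \<subseteq> I) \<longrightarrow>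
          disjoint_family_on (\<lambda>i. {u i<..<v i}) A \<longrightarrow> (\<Sum>i\<in>A. v i - u i) < \<delta> \<longrightarrow>
          (\<Sum>i\<in>A. \<bar>f (v i) - f (u i)\<bar>) < e"
    using abs_continuous_onD[OF ac \<open>e > 0\<close>, where ?'i = unit] by blast
  have *: "\<bar>f v - f u\<bar> < e" if "u < v" "u \<in> I" "v \<in> I" "v - u < \<delta>" for u v
  proof -
    have "{u..v} \<subseteq> I"
      using I that mem_is_interval_1_I[of I u v] by auto
    then show ?thesis
      using \<delta>[rule_format, of "{()}" "\<lambda>_. u" "\<lambda>_. v"] that
      by (simp add: disjoint_family_on_def)
  qed
  show "\<exists>d>0. \<forall>x'\<in>I. dist x' x < d \<longrightarrow> dist (f x') (f x) < e"
  proof (intro exI[of _ \<delta>] conjI ballI impI)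
    fix y assume y: "y \<in> I" "dist y x < \<delta>"
    consider "x < y" | "y < x" | "x = y" by linarith
    then show "dist (f y) (f x) < e"
      using *[of x y] *[of y x] x y \<open>e > 0\<close> by cases (auto simp: dist_real_def)
  qed fact
qed

text \<open>A null set lies in an open set of small measure, which contains non-overlapping cells
  covering the null set. Finitely many of these cells have small total length, so the increments of
  \<open>G\<close> over them have a small sum, which bounds the Stieltjes measure of their
  union.\<close>

lemma absolutely_continuous_interval_measure:
  assumes mono: "mono G" and ac: "abs_continuous_on UNIV G"
  shows "absolutely_continuous lborel (interval_measure G)"
proof -
  let ?\<mu> = "interval_measure G"
  have cont: "continuous_on UNIV G"
    by (rule abs_continuous_on_imp_continuous_on[OF ac]) simp
  have Icc: "emeasure ?\<mu> {x..y} = G y - G x" if "x \<le> y" for x y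
    using emeasure_interval_measure_Icc[OF that _ cont] mono by (auto dest: monoD)
  have small: "emeasure ?\<mu> N \<le> ennreal \<epsilon>"
    if N: "N \<in> null_sets lborel" and bd: "N \<subseteq> cbox x y" and "x < y" and "\<epsilon> > 0" for N x y \<epsilon>
  proof -
    obtain \<delta> where "\<delta> > 0" and \<delta>: "\<forall>(A :: real set set) u v. finite A \<longrightarrow> (\<forall>i\<in>A. u i < v i \<and> {u i..v i} \<subseteq> UNIV) \<longrightarrow>
          disjoint_family_on (\<lambda>i. {u i<..<v i}) A \<longrightarrow> (\<Sum>i\<in>A. v i - u i) < \<delta> \<longrightarrow>
          (\<Sum>i\<in>A. \<bar>G (v i) - G (u i)\<bar>) < \<epsilon>"
      using abs_continuous_onD[OF ac \<open>\<epsilon> > 0\<close>, where ?'i = "real set"] by blast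
    have N': "N \<in> null_sets lebesgue"
      using N by (simp add: null_sets_completionI)
    obtain T where T: "open T" "N \<subseteq> T" "T - N \<in> lmeasurable" "emeasure lebesgue (T - N) < ennreal \<delta>"
      using sets_lebesgue_outer_open[of N \<delta>] N' \<open>\<delta> > 0\<close> by blast
    have T\<delta>: "emeasure lebesgue T < ennreal \<delta>"
      using T(4) emeasure_Diff_null_set[OF N', of T] T(1) by simp
    \<comment> \<open>The value \<open>UNIV\<close> off \<open>T\<close> makes the function a gauge
      on the whole line. Every cell lies in the gauge set of some point of \<open>N\<close>, and
      \<open>N\<close> is contained in \<open>T\<close>, so all cells stay inside
      \<open>T\<close>.\<close>
    obtain \<D> where \<D>: "countable \<D>" "\<And>K. K \<in> \<D> \<Longrightarrow> interior K \<noteq> {} \<and> (\<exists>c d. K = cbox c d)"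
      "pairwise (\<lambda>A B. interior A \<inter> interior B = {}) \<D>"
      "\<And>K. K \<in> \<D> \<Longrightarrow> \<exists>x \<in> N \<inter> K. K \<subseteq> (if x \<in> T then T else UNIV)" "N \<subseteq> \<Union>\<D>"
    proof (rule covering_lemma[of N x y "\<lambda>x. if x \<in> T then T else UNIV"])
      show "gauge (\<lambda>x. if x \<in> T then T else UNIV)"
        using T(1) by (auto simp: gauge_def)
    qed (use bd \<open>x < y\<close> in \<open>auto\<close>)
    have sub: "K \<subseteq> T" if "K \<in> \<D>" for K
      using \<D>(4)[OF that] T(2) by (auto split: if_splits)
    have K: "Inf K < Sup K" "K = {Inf K..Sup K}" "interior K = {Inf K<..<Sup K}" if K\<D>: "K \<in> \<D>" for K
    proof -
      obtain c d where K: "K = {c..d}" "interior K \<noteq> {}"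
        using \<D>(2)[OF K\<D>] by auto
      then have "c < d" by simp
      then show "Inf K < Sup K" "K = {Inf K..Sup K}" "interior K = {Inf K<..<Sup K}"
        using K by auto
    qed
    \<comment> \<open>Lengths are measured on the disjoint interiors, which fit into
      \<open>T\<close>. The Stieltjes measure is taken on the closed cells, where continuity of
      \<open>G\<close> makes it equal to the increment.\<close>
    have fin: "emeasure ?\<mu> (\<Union>E) \<le> ennreal \<epsilon>" if E: "finite E" "E \<subseteq> \<D>" for E
    proof -
      have disj: "disjoint_family_on interior E"
        using pairwise_subset[OF \<D>(3) E(2)] by (simp add: disjoint_family_on_def pairwise_def)
      have "ennreal (\<Sum>K\<in>E. Sup K - Inf K) = (\<Sum>K\<in>E. emeasure lebesgue (interior K))"
      proof (subst sum_ennreal[symmetric])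
        show "0 \<le> Sup K - Inf K" if "K \<in> E" for K
          using K(1)[of K] E that by auto
        show "(\<Sum>K\<in>E. ennreal (Sup K - Inf K)) = (\<Sum>K\<in>E. emeasure lebesgue (interior K))"
        proof (rule sum.cong)
          fix K assume "K \<in> E"
          then have "K \<in> \<D>" using E by auto
          then show "ennreal (Sup K - Inf K) = emeasure lebesgue (interior K)"
            using K(1)[of K] unfolding K(3)[OF \<open>K \<in> \<D>\<close>] by simp
        qed simp
      qed
      also have "\<dots> = emeasure lebesgue (\<Union>K\<in>E. interior K)"
        using E disj by (intro sum_emeasure) auto
      also have "\<dots> \<le> emeasure lebesgue T"
      proof (rule emeasure_mono)
        show "\<Union> (interior ` E) \<subseteq> T"
          using E sub interior_subset by blast
      qed (use T in auto)
      finally have "ennreal (\<Sum>K\<in>E. Sup K - Inf K) < ennreal \<delta>"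
        using T\<delta> by order
      then have len: "(\<Sum>K\<in>E. Sup K - Inf K) < \<delta>"
      proof (subst (asm) ennreal_less_iff)
        show "0 \<le> (\<Sum>K\<in>E. Sup K - Inf K)"
          using K E by (intro sum_nonneg) (simp add: less_imp_le subset_iff)
      qed
      have "(\<Sum>K\<in>E. \<bar>G (Sup K) - G (Inf K)\<bar>) < \<epsilon>"
      proof (rule \<delta>[rule_format, OF E(1) _ _ len])
        show "disjoint_family_on (\<lambda>K. {Inf K<..<Sup K}) E"
          using disj K(3) E by (simp add: disjoint_family_on_def subset_iff)
        show "Inf i < Sup i \<and> {Inf i..Sup i} \<subseteq> UNIV" if "i \<in> E" for i
          using K(1)[of i] E that by auto
      qed
      moreover have "emeasure ?\<mu> (\<Union>E) \<le> (\<Sum>K\<in>E. emeasure ?\<mu> K)"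
      proof -
        have "K \<in> sets ?\<mu>" if "K \<in> E" for K
        proof -
          have "K = {Inf K..Sup K}" using K(2) E that by blast
          then show ?thesis by (metis atLeastAtMost_borel sets_interval_measure)
        qed
        then show ?thesis
          using emeasure_subadditive_finite[of E "\<lambda>x. x" ?\<mu>] E by auto
      qed
      moreover have "(\<Sum>K\<in>E. emeasure ?\<mu> K) = (\<Sum>K\<in>E. ennreal \<bar>G (Sup K) - G (Inf K)\<bar>)"
      proof (rule sum.cong)
        fix K assume "K \<in> E"
        then have "K \<in> \<D>" using E by auto
        then show "emeasure ?\<mu> K = ennreal \<bar>G (Sup K) - G (Inf K)\<bar>"
          using K(1,2)[of K] Icc[of "Inf K" "Sup K"] monoD[OF mono, of "Inf K" "Sup K"]
          by (metis abs_of_nonneg diff_ge_0_iff_ge less_imp_le)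
      qed simp
      moreover have "\<dots> = ennreal (\<Sum>K\<in>E. \<bar>G (Sup K) - G (Inf K)\<bar>)"
        by (rule sum_ennreal) simp
      ultimately show ?thesis
        by (simp only:) (meson ennreal_leI less_imp_le order_trans)
    qed
    show ?thesis
    proof (cases "\<D> = {}")
      case True
      then show ?thesis using \<D>(5) by simp
    next
      case False
      \<comment> \<open>\<open>from_nat_into\<close> enumerates the cells, possibly with
        repetitions, so the \<open>F n\<close> are increasing finite unions that exhaust the
        covering, and the bound passes to the limit by continuity from below.\<close>
      define F where "F n = \<Union>(from_nat_into \<D> ` {..<n})" for n :: nat
      have F: "emeasure ?\<mu> (F n) \<le> ennreal \<epsilon>" for n
        unfolding F_def using False by (intro fin) (simp_all add: image_subset_iff from_nat_into)
      have "from_nat_into \<D> i \<in> sets borel" for i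
        using K(2)[OF from_nat_into[OF False, of i]] by (metis atLeastAtMost_borel)
      then have meas: "F n \<in> sets borel" for n
        unfolding F_def by auto
      have UF: "(\<Union>n. F n) = \<Union>\<D>"
      proof -
        have "(\<Union>n. F n) = \<Union>(range (from_nat_into \<D>))"
          unfolding F_def by blast
        then show ?thesis using range_from_nat_into[OF False \<D>(1)] by simp
      qed
      have "emeasure ?\<mu> N \<le> emeasure ?\<mu> (\<Union>n. F n)"
      proof (rule emeasure_mono)
        show "(\<Union>n. F n) \<in> sets ?\<mu>"
          unfolding sets_interval_measure by (intro sets.countable_UN) (use meas in auto)
      qed (use \<D>(5) UF in simp)
      also have "\<dots> = (SUP n. emeasure ?\<mu> (F n))"
      proof (rule SUP_emeasure_incseq[symmetric])
        show "incseq F"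
          unfolding F_def by (intro monoI Union_mono image_mono) auto
      qed (use meas in auto)
      also have "\<dots> \<le> ennreal \<epsilon>"
        using F by (simp add: SUP_least)
      finally show ?thesis .
    qed
  qed
  show ?thesis
    unfolding absolutely_continuous_def
  proof
    fix N :: "real set" assume N: "N \<in> null_sets lborel"
    \<comment> \<open>The covering argument needs a bounded set, so \<open>N\<close> is cut into
      bounded pieces. \<open>Suc n\<close> keeps the box non-degenerate at
      \<open>n = 0\<close>.\<close>
    have "N \<inter> cbox (- real (Suc n)) (real (Suc n)) \<in> null_sets ?\<mu>" for n
    proof -
      let ?N = "N \<inter> cbox (- real (Suc n)) (real (Suc n))"
      have "?N \<in> null_sets lborel"
        using N by (simp add: null_set_Int2)
      then have le: "emeasure ?\<mu> ?N \<le> ennreal \<epsilon>" if "\<epsilon> > 0" for \<epsilon>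
        using that by (intro small[where x = "- real (Suc n)" and y = "real (Suc n)"]) auto
      have "emeasure ?\<mu> ?N \<le> 0"
        by (rule ennreal_le_epsilon) (simp only: add_0_left le)
      then show ?thesis using N by (auto simp: null_sets_def intro: sets.Int)
    qed
    then have "(\<Union>n. N \<inter> cbox (- real (Suc n)) (real (Suc n))) \<in> null_sets ?\<mu>"
      by (rule null_sets_UN)
    moreover have "(\<Union>n. N \<inter> cbox (- real (Suc n)) (real (Suc n))) = N"
    proof -
      have "\<exists>n. x \<in> cbox (- real (Suc n)) (real (Suc n))" for x
      proof -
        obtain n where "\<bar>x\<bar> < real n" using reals_Archimedean2 by blast
        then show ?thesis by (intro exI[of _ n]) auto
      qed
      then show ?thesis by blast
    qed
    ultimately show "N \<in> null_sets ?\<mu>" by simp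
  qed
qed

lemma mono_abs_continuous_density:
  assumes mono: "mono G" and ac: "abs_continuous_on UNIV G"
  obtains g where "\<And>x. 0 \<le> g x" and "\<And>x y. x \<le> y \<Longrightarrow> (g has_integral (G y - G x)) {x..y}"
proof -
  let ?\<mu> = "interval_measure G"
  have cont: "continuous_on UNIV G"
    by (rule abs_continuous_on_imp_continuous_on[OF ac]) simp
  have rcont: "continuous (at_right x) G" for x
    using cont by (auto simp: continuous_on_eq_continuous_within intro: continuous_within_subset)
  have Icc: "emeasure ?\<mu> {x..y} = G y - G x" if "x \<le> y" for x y
    using emeasure_interval_measure_Icc[OF that _ cont] mono by (auto dest: monoD)
  obtain f where f: "f \<in> borel_measurable lborel" "density lborel f = ?\<mu>"
    using sigma_finite_measure.Radon_Nikodym[OF sigma_finite_lborel absolutely_continuous_interval_measure[OF assms]] by auto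
  \<comment> \<open>Radon-Nikodym gives an extended-valued density. Sigma-finiteness of the
    Stieltjes measure makes it finite almost everywhere, so \<open>enn2real\<close> leaves its
    integrals unchanged.\<close>
  have "sigma_finite_measure ?\<mu>"
    using sigma_finite_interval_measure mono rcont by (auto dest: monoD)
  then have finite: "AE x in lborel. f x \<noteq> \<infinity>"
    using sigma_finite_measure.sigma_finite_iff_density_finite[OF sigma_finite_lborel f(1)] f(2) by simp
  show thesis
  proof (rule that[of "\<lambda>x. enn2real (f x)"])
    fix x y :: real assume "x \<le> y"
    have "(\<integral>\<^sup>+z. ennreal (enn2real (f z) * indicator {x..y} z) \<partial>lborel) = (\<integral>\<^sup>+z. f z * indicator {x..y} z \<partial>lborel)"
      using finite
      by (intro nn_integral_cong_AE) (auto split: split_indicator simp: less_top)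
    also have "\<dots> = emeasure ?\<mu> {x..y}"
      using f by (simp flip: f(2) add: emeasure_density)
    also have "\<dots> = ennreal (G y - G x)"
      using Icc \<open>x \<le> y\<close> by simp
    finally have "((\<lambda>z. enn2real (f z) * indicator {x..y} z) has_integral (G y - G x)) UNIV"
      using f(1) monoD[OF mono \<open>x \<le> y\<close>] by (intro nn_integral_has_integral) auto
    moreover have "(\<lambda>z. enn2real (f z) * indicator {x..y} z) = (\<lambda>z. if z \<in> {x..y} then enn2real (f z) else 0)"
      by auto
    ultimately show "((\<lambda>z. enn2real (f z)) has_integral (G y - G x)) {x..y}"
      by (simp only: has_integral_restrict_UNIV)
  qed simp
qed

subsection \<open>Variation along dyadic grids\<close>

lemma sum_lessThan_double:
  fixes g :: "nat \<Rightarrow> 'a::comm_monoid_add"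
  shows "(\<Sum>k<2 * m. g k) = (\<Sum>k<m. g (2 * k) + g (Suc (2 * k)))"
  by (induction m) (simp_all add: add.assoc)

text \<open>After rescaling, grid points in \<open>{u<..v}\<close> become integers between two
  floors, and there are at most \<open>(v - u) / h + 1\<close> of them. The extra \<open>h\<close>
  accounts for the first such cell, which may begin to the left of \<open>u\<close>.\<close>

lemma card_grid_Ioc_le:
  fixes u v a h :: real
  assumes "u < v" "h > 0"
  shows "real (card {k. k < n \<and> u < a + real (Suc k) * h \<and> a + real (Suc k) * h \<le> v}) * h \<le> v - u + h"
proof -
  let ?B = "{k. k < n \<and> u < a + real (Suc k) * h \<and> a + real (Suc k) * h \<le> v}"
  let ?p = "(u - a) / h" and ?q = "(v - a) / h"
  have pq: "?p \<le> ?q"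
    using assms by (simp add: divide_right_mono)
  have "card ?B \<le> card {\<lfloor>?p\<rfloor><..\<lfloor>?q\<rfloor>}"
  proof (rule card_inj_on_le)
    show "inj_on (\<lambda>k. int k + 1) ?B"
      by (auto simp: inj_on_def)
    show "(\<lambda>k. int k + 1) ` ?B \<subseteq> {\<lfloor>?p\<rfloor><..\<lfloor>?q\<rfloor>}"
    proof
      fix z assume "z \<in> (\<lambda>k. int k + 1) ` ?B"
      then obtain k where k: "z = int k + 1" "u < a + real (Suc k) * h" "a + real (Suc k) * h \<le> v"
        by auto
      have "?p < real_of_int z" "real_of_int z \<le> ?q"
        using k assms by (auto simp: pos_divide_less_eq pos_le_divide_eq algebra_simps)
      then show "z \<in> {\<lfloor>?p\<rfloor><..\<lfloor>?q\<rfloor>}"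
        by (simp add: floor_less_iff le_floor_iff)
    qed
  qed simp
  then have "real (card ?B) \<le> real (nat (\<lfloor>?q\<rfloor> - \<lfloor>?p\<rfloor>))"
    by simp
  also have "\<dots> \<le> ?q - ?p + 1"
    using floor_mono[OF pq] by linarith
  finally have "real (card ?B) * h \<le> (?q - ?p + 1) * h"
    using assms by (intro mult_right_mono) auto
  also have "\<dots> = v - u + h"
    using assms by (simp add: field_simps)
  finally show ?thesis .
qed

text \<open>\<open>V\<close> is the variation function of \<open>f\<close>, computed along nested
  grids only. It is therefore a pointwise limit of an increasing sequence, and inequalities for
  finite sums of increments pass to it directly. Continuity of \<open>f\<close> recovers the
  increments of \<open>f\<close> from the grid.\<close>

lemma abs_continuous_on_monotone_majorant:
  fixes a b :: real
  assumes "a < b" and ac: "abs_continuous_on {a..b} f"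
  obtains V where "mono V" "abs_continuous_on UNIV V"
    "\<And>x y. \<lbrakk>a \<le> x; x \<le> y; y \<le> b\<rbrakk> \<Longrightarrow> \<bar>f y - f x\<bar> \<le> V y - V x"
    "\<And>x. V (max a (min b x)) = V x"
proof -
  define h where "h n = (b - a) / 2 ^ n" for n :: nat
  define t where "t n k = a + real k * h n" for n k
  \<comment> \<open>A cell counts once its right end is at most \<open>x\<close>. Since
    \<open>S\<close> uses the same condition, increments of \<open>S\<close> and \<open>W\<close>
    can be compared cell by cell.\<close>
  define W where "W n x = (\<Sum>k<2 ^ n. if t n (Suc k) \<le> x then \<bar>f (t n (Suc k)) - f (t n k)\<bar> else 0)" for n x
  define S where "S n x = (\<Sum>k<2 ^ n. if t n (Suc k) \<le> x then f (t n (Suc k)) - f (t n k) else 0)" for n x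
  have h_pos: "h n > 0" for n
    using \<open>a < b\<close> by (simp add: h_def)
  have h_Suc: "h n = 2 * h (Suc n)" for n
    by (simp add: h_def field_simps)
  have h_lim: "h \<longlonglongrightarrow> 0"
    unfolding h_def by (rule LIMSEQ_divide_realpow_zero) simp
  have h_anti: "h n \<le> h m" if "m \<le> n" for m n
    unfolding h_def using \<open>a < b\<close> that by (intro divide_left_mono) (auto intro: power_increasing)
  have t_mono: "t n j \<le> t n k" if "j \<le> k" for n j k
    unfolding t_def using h_pos[of n] that by (simp add: mult_right_mono less_imp_le)
  have t_diff: "t n (Suc k) - t n k = h n" for n k
    by (simp add: t_def algebra_simps)
  have t_top: "t n (2 ^ n) = b" and t_0: "t n 0 = a" for n
    by (simp_all add: t_def h_def)
  have t_in: "t n k \<in> {a..b}" if "k \<le> 2 ^ n" for n k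
    using t_mono[of 0 k n] t_mono[OF that, of n] t_top t_0 by auto
  have W_mono: "W n x \<le> W n y" if "x \<le> y" for n x y
    unfolding W_def using that by (intro sum_mono) auto
  have W_Suc: "W n x \<le> W (Suc n) x" for n x
  proof -
    have eq: "t (Suc n) (2 * k) = t n k" "t (Suc n) (Suc (Suc (2 * k))) = t n (Suc k)" for k
      unfolding t_def h_Suc[of n] by (simp_all add: algebra_simps)
    have le: "t (Suc n) (Suc (2 * k)) \<le> t n (Suc k)" for k
      using t_mono[of "Suc (2 * k)" "Suc (Suc (2 * k))" "Suc n"] eq by simp
    \<comment> \<open>The two summands belong to the halves of cell \<open>k\<close>. The left half
      may count before the whole cell does, which only increases the sum; once the whole cell
      counts, the triangle inequality applies.\<close>
    have "W (Suc n) x = (\<Sum>k<2 ^ n.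
        (if t (Suc n) (Suc (2 * k)) \<le> x then \<bar>f (t (Suc n) (Suc (2 * k))) - f (t n k)\<bar> else 0) +
        (if t n (Suc k) \<le> x then \<bar>f (t n (Suc k)) - f (t (Suc n) (Suc (2 * k)))\<bar> else 0))"
      unfolding W_def power_Suc sum_lessThan_double eq ..
    also have "W n x \<le> \<dots>"
      unfolding W_def
    proof (rule sum_mono)
      fix k
      show "(if t n (Suc k) \<le> x then \<bar>f (t n (Suc k)) - f (t n k)\<bar> else 0) \<le>
        (if t (Suc n) (Suc (2 * k)) \<le> x then \<bar>f (t (Suc n) (Suc (2 * k))) - f (t n k)\<bar> else 0) +
        (if t n (Suc k) \<le> x then \<bar>f (t n (Suc k)) - f (t (Suc n) (Suc (2 * k)))\<bar> else 0)"
        using le[of k] by auto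
    qed
    finally show ?thesis .
  qed
  then have W_inc: "incseq (\<lambda>n. W n x)" for x
    by (rule incseq_SucI)
  \<comment> \<open>An increment of \<open>W n\<close> sums over the grid cells whose right end lies in \<open>{u<..v}\<close>; up to one
    cell per interval, their total length is that of the intervals.\<close>
  have small: "\<exists>\<delta>>0. \<forall>n (A :: nat set) u v. finite A \<longrightarrow> (\<forall>i\<in>A. u i < v i) \<longrightarrow>
      disjoint_family_on (\<lambda>i. {u i<..<v i}) A \<longrightarrow> (\<Sum>i\<in>A. v i - u i) + real (card A) * h n < \<delta> \<longrightarrow>
      (\<Sum>i\<in>A. W n (v i) - W n (u i)) < \<epsilon>" if "\<epsilon> > 0" for \<epsilon>
  proof -
    obtain \<delta> where "\<delta> > 0" and \<delta>: "\<forall>(A :: nat set) u v. finite A \<longrightarrow> (\<forall>i\<in>A. u i < v i \<and> {u i..v i} \<subseteq> {a..b}) \<longrightarrow>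
          disjoint_family_on (\<lambda>i. {u i<..<v i}) A \<longrightarrow> (\<Sum>i\<in>A. v i - u i) < \<delta> \<longrightarrow>
          (\<Sum>i\<in>A. \<bar>f (v i) - f (u i)\<bar>) < \<epsilon>"
      using abs_continuous_onD[OF ac \<open>\<epsilon> > 0\<close>, where ?'i = nat] by blast
    show ?thesis
    proof (intro exI[of _ \<delta>] conjI allI impI)
      fix n A and u v :: "nat \<Rightarrow> real"
      assume "finite A" and uv: "\<forall>i\<in>A. u i < v i" and disj: "disjoint_family_on (\<lambda>i. {u i<..<v i}) A"
        and len: "(\<Sum>i\<in>A. v i - u i) + real (card A) * h n < \<delta>"
      define B where "B i = {k. k < 2 ^ n \<and> u i < t n (Suc k) \<and> t n (Suc k) \<le> v i}" for i
      have fin: "finite (B i)" for i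
        unfolding B_def by simp
      have B_disj: "B i \<inter> B j = {}" if "i \<in> A" "j \<in> A" "i \<noteq> j" for i j
      proof (rule ccontr)
        assume "B i \<inter> B j \<noteq> {}"
        then obtain k where k: "u i < t n (Suc k)" "t n (Suc k) \<le> v i" "u j < t n (Suc k)" "t n (Suc k) \<le> v j"
          unfolding B_def by auto
        \<comment> \<open>The common grid point may be a right endpoint of both intervals, hence
          outside the open intervals. A point slightly to its left lies in both.\<close>
        obtain z where "max (u i) (u j) < z" "z < t n (Suc k)"
          using dense[of "max (u i) (u j)" "t n (Suc k)"] k by auto
        then have "z \<in> {u i<..<v i} \<inter> {u j<..<v j}"
          using k by auto
        then show False
          using disj that unfolding disjoint_family_on_def by blast
      qed
      have "W n (v i) - W n (u i) = (\<Sum>k\<in>B i. \<bar>f (t n (Suc k)) - f (t n k)\<bar>)" if "i \<in> A" for i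
      proof -
        have "W n (v i) - W n (u i) =
            (\<Sum>k<2 ^ n. if u i < t n (Suc k) \<and> t n (Suc k) \<le> v i then \<bar>f (t n (Suc k)) - f (t n k)\<bar> else 0)"
          unfolding W_def sum_subtractf[symmetric]
          using uv that by (intro sum.cong) force+
        also have "\<dots> = (\<Sum>k\<in>B i. \<bar>f (t n (Suc k)) - f (t n k)\<bar>)"
          unfolding B_def by (simp add: sum.inter_filter[symmetric])
        finally show ?thesis .
      qed
      then have "(\<Sum>i\<in>A. W n (v i) - W n (u i)) = (\<Sum>i\<in>A. \<Sum>k\<in>B i. \<bar>f (t n (Suc k)) - f (t n k)\<bar>)"
        by simp
      also have "\<dots> = (\<Sum>k\<in>\<Union>(B ` A). \<bar>f (t n (Suc k)) - f (t n k)\<bar>)"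
        using \<open>finite A\<close> fin B_disj by (intro sum.UNION_disjoint[symmetric]) auto
      also have "\<dots> < \<epsilon>"
      proof (rule \<delta>[rule_format])
        show "finite (\<Union>(B ` A))"
          using \<open>finite A\<close> fin by simp
        show "t n k < t n (Suc k) \<and> {t n k..t n (Suc k)} \<subseteq> {a..b}" if "k \<in> \<Union>(B ` A)" for k
          using that t_diff[of n k] h_pos[of n] t_in[of k n] t_in[of "Suc k" n] by (auto simp: B_def)
        have "{t n i<..<t n (Suc i)} \<inter> {t n j<..<t n (Suc j)} = {}" if "i < j" for i j
          using t_mono[of "Suc i" j n] that by auto
        then show "disjoint_family_on (\<lambda>k. {t n k<..<t n (Suc k)}) (\<Union>(B ` A))"
          unfolding disjoint_family_on_def by (metis Int_commute linorder_neqE_nat)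
        have "(\<Sum>k\<in>\<Union>(B ` A). t n (Suc k) - t n k) = (\<Sum>i\<in>A. \<Sum>k\<in>B i. h n)"
          unfolding t_diff using \<open>finite A\<close> fin B_disj by (intro sum.UNION_disjoint) auto
        also have "\<dots> \<le> (\<Sum>i\<in>A. v i - u i + h n)"
        proof (rule sum_mono)
          fix i assume "i \<in> A"
          then have "real (card (B i)) * h n \<le> v i - u i + h n"
            using card_grid_Ioc_le[of "u i" "v i" "h n" "2 ^ n" a] uv h_pos[of n]
            unfolding B_def t_def by blast
          then show "(\<Sum>k\<in>B i. h n) \<le> v i - u i + h n"
            by simp
        qed
        also have "\<dots> = (\<Sum>i\<in>A. v i - u i) + real (card A) * h n"
          by (simp add: sum.distrib)
        finally show "(\<Sum>k\<in>\<Union>(B ` A). t n (Suc k) - t n k) < \<delta>"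
          using len by linarith
      qed
      finally show "(\<Sum>i\<in>A. W n (v i) - W n (u i)) < \<epsilon>" .
    qed fact
  qed
  obtain C where C: "\<And>n x. W n x \<le> C"
  proof -
    obtain \<delta> where "\<delta> > 0" and \<delta>: "\<forall>n (A :: nat set) u v. finite A \<longrightarrow> (\<forall>i\<in>A. u i < v i) \<longrightarrow>
      disjoint_family_on (\<lambda>i. {u i<..<v i}) A \<longrightarrow> (\<Sum>i\<in>A. v i - u i) + real (card A) * h n < \<delta> \<longrightarrow>
      (\<Sum>i\<in>A. W n (v i) - W n (u i)) < 1"
      using small[of 1] by auto
    \<comment> \<open>For \<open>n\<close> at least \<open>m\<close>, a cell of grid
      \<open>m\<close> has length \<open>h m\<close> and the overshoot is \<open>h n\<close>, at
      most \<open>h m\<close>. With \<open>h m\<close> below half of \<open>\<delta>\<close>, each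
      of the \<open>2 ^ m\<close> cells contributes at most 1 to \<open>W n b\<close>, a bound
      independent of \<open>n\<close>.\<close>
    have "eventually (\<lambda>n. h n < \<delta> / 2) sequentially"
      using h_lim \<open>\<delta> > 0\<close> by (intro order_tendstoD) auto
    then obtain m where m: "h m < \<delta> / 2"
      by (auto simp: eventually_sequentially)
    have bound: "W n b \<le> 2 ^ m" if "m \<le> n" for n
    proof -
      have "W n (t m (Suc j)) - W n (t m j) \<le> 1" for j
        using \<delta>[rule_format, of "{0}" "\<lambda>_. t m j" "\<lambda>_. t m (Suc j)" n] t_diff[of m j] h_pos[of m] m h_anti[OF that]
        by (simp add: disjoint_family_on_def)
      then have "(\<Sum>j<2 ^ m. W n (t m (Suc j)) - W n (t m j)) \<le> (\<Sum>j<(2::nat) ^ m. 1)"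
        by (intro sum_mono)
      moreover have "(\<Sum>j<2 ^ m. W n (t m (Suc j)) - W n (t m j)) = W n b - W n a"
        using sum_lessThan_telescope[of "\<lambda>j. W n (t m j)" "2 ^ m"] by (simp only: t_top t_0)
      moreover have "W n a = 0"
      proof -
        have "\<not> t n (Suc k) \<le> a" for k
          using h_pos[of n] by (simp add: t_def add_pos_nonneg not_le)
        then show ?thesis unfolding W_def by simp
      qed
      ultimately show ?thesis by simp
    qed
    have "W n x \<le> 2 ^ m" for n x
    proof -
      have "W n x \<le> W n b"
        unfolding W_def using t_in by (intro sum_mono) (auto simp: Suc_le_eq)
      \<comment> \<open>Grids coarser than grid \<open>m\<close> are dominated by finer ones, to
        which the bound applies.\<close>
      also have "\<dots> \<le> W (max m n) b"
        using incseqD[OF W_inc] by simp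
      also have "\<dots> \<le> 2 ^ m"
        by (rule bound) simp
      finally show ?thesis .
    qed
    then show thesis by (rule that)
  qed
  define V where "V x = (SUP n. W n x)" for x
  have V: "(\<lambda>n. W n x) \<longlonglongrightarrow> V x" for x
    unfolding V_def using C W_inc by (intro LIMSEQ_incseq_SUP) (auto simp: bdd_above_def)
  show thesis
  proof (rule that)
    show V_mono: "mono V"
      using W_mono by (auto intro!: monoI LIMSEQ_le[OF V V])
    show "abs_continuous_on UNIV V"
      unfolding abs_continuous_on_def
    proof (intro allI impI)
      fix \<epsilon> :: real assume "\<epsilon> > 0"
      obtain \<delta> where "\<delta> > 0" and \<delta>: "\<forall>n (A :: nat set) u v. finite A \<longrightarrow> (\<forall>i\<in>A. u i < v i) \<longrightarrow>
        disjoint_family_on (\<lambda>i. {u i<..<v i}) A \<longrightarrow> (\<Sum>i\<in>A. v i - u i) + real (card A) * h n < \<delta> \<longrightarrow>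
        (\<Sum>i\<in>A. W n (v i) - W n (u i)) < \<epsilon> / 2"
        using small[of "\<epsilon> / 2"] \<open>\<epsilon> > 0\<close> by auto
      show "\<exists>\<delta>>0. \<forall>(n::nat) u v. (\<forall>i<n. u i < v i \<and> {u i..v i} \<subseteq> UNIV) \<and>
          disjoint_family_on (\<lambda>i. {u i<..<v i}) {..<n} \<and> (\<Sum>i<n. v i - u i) < \<delta> \<longrightarrow>
          (\<Sum>i<n. \<bar>V (v i) - V (u i)\<bar>) < \<epsilon>"
      proof (intro exI[of _ \<delta>] conjI allI impI, fact, elim conjE)
        fix N :: nat and u v
        assume uv: "\<forall>i<N. u i < v i \<and> {u i..v i} \<subseteq> UNIV"
          and disj: "disjoint_family_on (\<lambda>i. {u i<..<v i}) {..<N}"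
          and len: "(\<Sum>i<N. v i - u i) < \<delta>"
        \<comment> \<open>For a fixed finite family the overshoot tends to 0, so the estimate for
          \<open>W n\<close> applies for all large \<open>n\<close>. The limit preserves only the
          weak inequality, hence the earlier choice of \<open>\<epsilon> / 2\<close>.\<close>
        have "(\<lambda>n. (\<Sum>i<N. v i - u i) + real (card {..<N}) * h n) \<longlonglongrightarrow> (\<Sum>i<N. v i - u i) + real (card {..<N}) * 0"
          by (intro tendsto_intros h_lim)
        then have "eventually (\<lambda>n. (\<Sum>i<N. v i - u i) + real (card {..<N}) * h n < \<delta>) sequentially"
          using len by (intro order_tendstoD) auto
        then have "eventually (\<lambda>n. (\<Sum>i<N. W n (v i) - W n (u i)) \<le> \<epsilon> / 2) sequentially"
        proof eventually_elim
          case (elim n)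
          show ?case
            using \<delta>[rule_format, OF _ _ disj elim] uv by (simp add: less_imp_le)
        qed
        moreover have "(\<lambda>n. \<Sum>i<N. W n (v i) - W n (u i)) \<longlonglongrightarrow> (\<Sum>i<N. V (v i) - V (u i))"
          by (intro tendsto_intros V)
        ultimately have "(\<Sum>i<N. V (v i) - V (u i)) \<le> \<epsilon> / 2"
          by (intro tendsto_upperbound) auto
        moreover have "(\<Sum>i<N. \<bar>V (v i) - V (u i)\<bar>) = (\<Sum>i<N. V (v i) - V (u i))"
          using uv by (intro sum.cong) (auto simp: monoD[OF V_mono] less_imp_le)
        ultimately show "(\<Sum>i<N. \<bar>V (v i) - V (u i)\<bar>) < \<epsilon>"
          using \<open>\<epsilon> > 0\<close> by linarith
      qed
    qed
    have S: "(\<lambda>n. S n x) \<longlonglongrightarrow> f x - f a" if x: "a \<le> x" "x \<le> b" for x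
    proof -
      \<comment> \<open>\<open>K n\<close> is the index of the last grid point not beyond
        \<open>x\<close>. The signed sum \<open>S n x\<close> telescopes to the increment of
        \<open>f\<close> from \<open>a\<close> to that point, which tends to
        \<open>x\<close>.\<close>
      define K where "K n = nat \<lfloor>(x - a) / h n\<rfloor>" for n
      have Kle: "real (K n) * h n \<le> x - a" and Kge: "x - a < real (Suc (K n)) * h n" for n
      proof -
        have nonneg: "0 \<le> (x - a) / h n"
          using x h_pos[of n] by simp
        then have "real (K n) \<le> (x - a) / h n" "(x - a) / h n < real (Suc (K n))"
          unfolding K_def by linarith+
        then show "real (K n) * h n \<le> x - a" "x - a < real (Suc (K n)) * h n"
          using h_pos[of n] by (simp_all only: pos_le_divide_eq pos_divide_less_eq)
      qed
      have iff: "t n (Suc k) \<le> x \<longleftrightarrow> k < K n" for n k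
      proof
        assume "t n (Suc k) \<le> x"
        then have "real (Suc k) * h n < real (Suc (K n)) * h n"
          using Kge[of n] by (simp add: t_def)
        then show "k < K n"
          using h_pos[of n] by (simp only: mult_less_cancel_right) simp
      next
        assume "k < K n"
        then have "real (Suc k) * h n \<le> real (K n) * h n"
          using h_pos[of n] by (intro mult_right_mono) auto
        then show "t n (Suc k) \<le> x"
          using Kle[of n] by (simp add: t_def)
      qed
      have K_top: "K n \<le> 2 ^ n" for n
      proof (rule ccontr)
        assume "\<not> K n \<le> 2 ^ n"
        then have "t n (Suc (2 ^ n)) \<le> x" by (simp add: iff)
        then show False
          using t_diff[of n "2 ^ n"] t_top[of n] h_pos[of n] x by linarith
      qed
      have "S n x = f (t n (K n)) - f a" for n
      proof -
        have "S n x = (\<Sum>k<K n. f (t n (Suc k)) - f (t n k))"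
          unfolding S_def iff using K_top[of n]
          by (intro sum.mono_neutral_cong_right) auto
        also have "\<dots> = f (t n (K n)) - f a"
          using sum_lessThan_telescope[of "\<lambda>k. f (t n k)" "K n"] by (simp only: t_0)
        finally show ?thesis .
      qed
      moreover have "(\<lambda>n. t n (K n)) \<longlonglongrightarrow> x"
      proof (rule tendsto_sandwich)
        show "eventually (\<lambda>n. x - h n \<le> t n (K n)) sequentially"
          using Kge by (intro always_eventually) (simp add: t_def algebra_simps less_imp_le)
        show "eventually (\<lambda>n. t n (K n) \<le> x) sequentially"
          using Kle by (intro always_eventually) (simp add: t_def algebra_simps)
        show "(\<lambda>n. x - h n) \<longlonglongrightarrow> x"
          using tendsto_diff[OF tendsto_const[of x] h_lim] by simp
      qed simp
      then have "(\<lambda>n. f (t n (K n))) \<longlonglongrightarrow> f x"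
        using abs_continuous_on_imp_continuous_on[OF ac] x t_in K_top
        by (intro continuous_on_tendsto_compose[of "{a..b}" f]) (auto simp: is_interval_cc)
      ultimately show ?thesis
        by (auto intro!: tendsto_intros)
    qed
    show "V (max a (min b x)) = V x" for x
    proof -
      \<comment> \<open>All right ends of cells lie in \<open>{a<..b}\<close>, so clamping
        \<open>x\<close> does not change which of them are at most \<open>x\<close>.\<close>
      have "t n (Suc k) \<le> max a (min b x) \<longleftrightarrow> t n (Suc k) \<le> x" if "k < 2 ^ n" for n k
        using t_in[of "Suc k" n] t_in[of k n] t_diff[of n k] h_pos[of n] that by auto
      then have "W n (max a (min b x)) = W n x" for n
        unfolding W_def by (intro sum.cong) simp_all
      then show ?thesis
        unfolding V_def by simp
    qed
    show "\<bar>f y - f x\<bar> \<le> V y - V x" if xy: "a \<le> x" "x \<le> y" "y \<le> b" for x y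
    proof (rule LIMSEQ_le)
      show "(\<lambda>n. \<bar>S n y - S n x\<bar>) \<longlonglongrightarrow> \<bar>f y - f x\<bar>"
        using tendsto_rabs[OF tendsto_diff[OF S[of y] S[of x]]] xy by simp
      show "(\<lambda>n. W n y - W n x) \<longlonglongrightarrow> V y - V x"
        by (intro tendsto_intros V)
      have "\<bar>S n y - S n x\<bar> \<le> W n y - W n x" for n
        unfolding S_def W_def sum_subtractf[symmetric] using xy
        by (intro order_trans[OF sum_abs] sum_mono) auto
      then show "\<exists>N. \<forall>n\<ge>N. \<bar>S n y - S n x\<bar> \<le> W n y - W n x"
        by blast
    qed
  qed
qed

subsection \<open>Increments and the derivative\<close>

text \<open>This is Lebesgue differentiation in the form of
  \<open>integrable_ccontinuous_explicit\<close>, whose cubes have \<open>x\<close> as their lower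
  corner. In dimension one that controls the right-hand quotient.\<close>

lemma indefinite_integral_right_quotient:
  fixes h F :: "real \<Rightarrow> real"
  assumes F: "\<And>x y. x \<le> y \<Longrightarrow> (h has_integral (F y - F x)) {x..y}"
  obtains N where "negligible N"
    "\<And>x. x \<notin> N \<Longrightarrow> ((\<lambda>t. (F (x + t) - F x) / t) \<longlongrightarrow> h x) (at_right 0)"
proof -
  have "h integrable_on cbox x y" for x y
  proof (cases "x \<le> y")
    case True
    then show ?thesis using F by auto
  qed auto
  then obtain N where N: "negligible N"
    and lim: "\<And>x e. \<lbrakk>x \<notin> N; 0 < e\<rbrakk> \<Longrightarrow> \<exists>d>0. \<forall>t. 0 < t \<and> t < d \<longrightarrow>
        norm (integral (cbox x (x + t *\<^sub>R One)) h /\<^sub>R t ^ DIM(real) - h x) < e"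
    using integrable_ccontinuous_explicit by metis
  show thesis
  proof (rule that[OF N])
    fix x assume "x \<notin> N"
    show "((\<lambda>t. (F (x + t) - F x) / t) \<longlongrightarrow> h x) (at_right 0)"
    proof (rule tendstoI)
      fix e :: real assume "e > 0"
      then obtain d where "d > 0" and d: "\<And>t. 0 < t \<and> t < d \<Longrightarrow>
          norm (integral (cbox x (x + t *\<^sub>R One)) h /\<^sub>R t ^ DIM(real) - h x) < e"
        using lim[OF \<open>x \<notin> N\<close>] by blast
      have "dist ((F (x + t) - F x) / t) (h x) < e" if t: "0 < t" "t < d" for t
      proof -
        have "integral {x..x + t} h = F (x + t) - F x"
          using F[of x "x + t"] t by (simp add: integral_unique)
        then show ?thesis
          using d[of t] t by (simp add: dist_real_def divide_inverse mult.commute)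
      qed
      then show "eventually (\<lambda>t. dist ((F (x + t) - F x) / t) (h x) < e) (at_right 0)"
        using \<open>d > 0\<close> by (auto simp: eventually_at_right_field)
    qed
  qed
qed

text \<open>The left-hand quotient at \<open>x\<close> is the right-hand quotient at
  \<open>- x\<close> for the reflected pair \<open>h (- x)\<close> and \<open>- F (- x)\<close>. Off
  the union of both exceptional sets the two one-sided limits agree.\<close>

lemma indefinite_integral_has_derivative_AE:
  fixes h F :: "real \<Rightarrow> real"
  assumes F: "\<And>x y. x \<le> y \<Longrightarrow> (h has_integral (F y - F x)) {x..y}"
  obtains N where "negligible N" "\<And>x. x \<notin> N \<Longrightarrow> (F has_real_derivative h x) (at x)"
proof -
  obtain N where N: "negligible N"
    "\<And>x. x \<notin> N \<Longrightarrow> ((\<lambda>t. (F (x + t) - F x) / t) \<longlongrightarrow> h x) (at_right 0)"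
    using indefinite_integral_right_quotient[OF F] by blast
  have "((\<lambda>x. h (- x)) has_integral (- F (- y) - - F (- x))) {x..y}" if "x \<le> y" for x y
    using F[of "- y" "- x"] that has_integral_reflect_real[of h "F (- x) - F (- y)" "- x" "- y"] by simp
  then obtain M where M: "negligible M"
    "\<And>x. x \<notin> M \<Longrightarrow> ((\<lambda>t. (- F (- (x + t)) - - F (- x)) / t) \<longlongrightarrow> h (- x)) (at_right 0)"
    using indefinite_integral_right_quotient[of "\<lambda>x. h (- x)" "\<lambda>x. - F (- x)"] by blast
  show thesis
  proof (rule that)
    have "negligible (uminus ` M)"
      by (intro negligible_differentiable_image_negligible M(1) differentiable_on_minus differentiable_on_ident) simp
    then show "negligible (N \<union> uminus ` M)"
      using N(1) by simp
    fix x assume x: "x \<notin> N \<union> uminus ` M"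
    then have "- x \<notin> M" by (metis UnI2 imageI minus_minus)
    have "((\<lambda>t. (F (x + t) - F x) / t) \<longlongrightarrow> h x) (at_left 0)"
      unfolding filterlim_at_left_to_right minus_zero
    proof (rule tendsto_cong[THEN iffD1, OF _ M(2)[OF \<open>- x \<notin> M\<close>, unfolded minus_minus]])
      show "\<forall>\<^sub>F t in at_right 0. (- F (- (- x + t)) - - F x) / t = (F (x + - t) - F x) / - t"
        by (intro always_eventually) (simp add: diff_divide_distrib)
    qed
    moreover have "((\<lambda>t. (F (x + t) - F x) / t) \<longlongrightarrow> h x) (at_right 0)"
      using N(2) x by simp
    ultimately show "(F has_real_derivative h x) (at x)"
      unfolding DERIV_def by (rule filterlim_split_at)
  qed
qed

text \<open>Writing \<open>f\<close> as the difference of the monotone functions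
  \<open>V + F\<close> and \<open>V\<close> exhibits it as an indefinite integral of
  \<open>h\<close>, and \<open>h\<close> is its derivative almost everywhere.\<close>

lemma abs_continuous_on_increment_le_integral_deriv:
  fixes a b c d :: real
  assumes "a < b" and ac: "abs_continuous_on {a..b} f" and cd: "a \<le> c" "c < d" "d \<le> b"
  shows "ennreal \<bar>f d - f c\<bar> \<le> (\<integral>\<^sup>+x. ennreal \<bar>deriv f x\<bar> * indicator {c<..<d} x \<partial>lebesgue)"
proof -
  obtain V where V: "mono V" "abs_continuous_on UNIV V"
    and maj: "\<And>x y. \<lbrakk>a \<le> x; x \<le> y; y \<le> b\<rbrakk> \<Longrightarrow> \<bar>f y - f x\<bar> \<le> V y - V x"
    and clamp: "\<And>x. V (max a (min b x)) = V x"
    using abs_continuous_on_monotone_majorant[OF \<open>a < b\<close> ac] by blast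
  \<comment> \<open>Extending \<open>f\<close> by constants gives functions on the whole line, where
    Stieltjes measures are defined. Since \<open>V\<close> is invariant under the same clamping, it
    still dominates the increments.\<close>
  define F where "F x = f (max a (min b x))" for x
  have F_le: "\<bar>F y - F x\<bar> \<le> V y - V x" if "x \<le> y" for x y
    unfolding F_def clamp[of x, symmetric] clamp[of y, symmetric]
    using that \<open>a < b\<close> by (intro maj) auto
  have mono: "mono (\<lambda>x. V x + F x)"
  proof (rule monoI)
    fix x y :: real assume "x \<le> y"
    then show "V x + F x \<le> V y + F y"
      using F_le[OF \<open>x \<le> y\<close>] by linarith
  qed
  have "abs_continuous_on UNIV (\<lambda>x. V x + F x)"
    unfolding abs_continuous_on_def
  proof (intro allI impI)
    fix \<epsilon> :: real assume "\<epsilon> > 0"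
    \<comment> \<open>Increments of \<open>V + F\<close> are at most twice those of
      \<open>V\<close>, hence half of \<open>\<epsilon>\<close> for \<open>V\<close>.\<close>
    then have "\<epsilon> / 2 > 0" by simp
    then obtain \<delta> where "\<delta> > 0" and \<delta>: "\<forall>(n::nat) u v. (\<forall>i<n. u i < v i \<and> {u i..v i} \<subseteq> UNIV) \<and>
      disjoint_family_on (\<lambda>i. {u i<..<v i}) {..<n} \<and> (\<Sum>i<n. v i - u i) < \<delta>
      \<longrightarrow> (\<Sum>i<n. \<bar>V (v i) - V (u i)\<bar>) < \<epsilon> / 2"
      using V(2) unfolding abs_continuous_on_def by blast
    show "\<exists>\<delta>>0. \<forall>(n::nat) u v. (\<forall>i<n. u i < v i \<and> {u i..v i} \<subseteq> UNIV) \<and>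
      disjoint_family_on (\<lambda>i. {u i<..<v i}) {..<n} \<and> (\<Sum>i<n. v i - u i) < \<delta>
      \<longrightarrow> (\<Sum>i<n. \<bar>V (v i) + F (v i) - (V (u i) + F (u i))\<bar>) < \<epsilon>"
    proof (intro exI[of _ \<delta>] conjI allI impI, fact)
      fix n :: nat and u v
      assume uv: "(\<forall>i<n. u i < v i \<and> {u i..v i} \<subseteq> UNIV) \<and>
        disjoint_family_on (\<lambda>i. {u i<..<v i}) {..<n} \<and> (\<Sum>i<n. v i - u i) < \<delta>"
      have "(\<Sum>i<n. \<bar>V (v i) + F (v i) - (V (u i) + F (u i))\<bar>) \<le> (\<Sum>i<n. 2 * \<bar>V (v i) - V (u i)\<bar>)"
      proof (rule sum_mono)
        fix i assume "i \<in> {..<n}"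
        then have "u i \<le> v i"
          using uv by (simp add: less_imp_le)
        then show "\<bar>V (v i) + F (v i) - (V (u i) + F (u i))\<bar> \<le> 2 * \<bar>V (v i) - V (u i)\<bar>"
          using F_le[of "u i" "v i"] abs_ge_self[of "V (v i) - V (u i)"]
            abs_triangle_ineq[of "V (v i) - V (u i)" "F (v i) - F (u i)"] by (simp add: algebra_simps)
      qed
      also have "\<dots> = 2 * (\<Sum>i<n. \<bar>V (v i) - V (u i)\<bar>)"
        by (simp add: sum_distrib_left)
      also have "\<dots> < \<epsilon>"
        using \<delta>[rule_format, OF uv] by simp
      finally show "(\<Sum>i<n. \<bar>V (v i) + F (v i) - (V (u i) + F (u i))\<bar>) < \<epsilon>" .
    qed
  qed
  then obtain g where g: "\<And>x. 0 \<le> g x" "\<And>x y. x \<le> y \<Longrightarrow> (g has_integral (V y + F y - (V x + F x))) {x..y}"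
    using mono_abs_continuous_density[OF mono] by blast
  obtain k where k: "\<And>x. 0 \<le> k x" "\<And>x y. x \<le> y \<Longrightarrow> (k has_integral (V y - V x)) {x..y}"
    using mono_abs_continuous_density[OF V] by blast
  define h where "h x = g x - k x" for x
  have h: "(h has_integral (F y - F x)) {x..y}" if "x \<le> y" for x y
    using has_integral_diff[OF g(2)[OF that] k(2)[OF that]] unfolding h_def
    by (simp add: algebra_simps)
  have "g absolutely_integrable_on {c..d}" "k absolutely_integrable_on {c..d}"
    using g(1) g(2)[of c d] k(1) k(2)[of c d] cd
    by (auto intro!: nonnegative_absolutely_integrable_1 simp: integrable_on_def)
  then have h_abs: "h absolutely_integrable_on {c..d}"
    unfolding h_def by (rule set_integral_diff)
  obtain N where N: "negligible N" "\<And>x. x \<notin> N \<Longrightarrow> (F has_real_derivative h x) (at x)"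
    using indefinite_integral_has_derivative_AE[OF h] by blast
  \<comment> \<open>\<open>deriv\<close> is two-sided and \<open>F\<close> is known to agree with
    \<open>f\<close> only on \<open>{a..b}\<close>, so derivatives are compared on the open
    interval.\<close>
  have deriv: "deriv f x = h x" if "x \<in> {c<..<d}" "x \<notin> N" for x
  proof (rule DERIV_imp_deriv)
    show "(f has_real_derivative h x) (at x)"
    proof (rule has_field_derivative_transform_within_open[OF N(2)[OF that(2)] _ that(1)])
      show "F y = f y" if "y \<in> {c<..<d}" for y
        using that cd by (simp add: F_def max_def min_def)
    qed simp
  qed
  have "F d - F c = integral {c..d} h"
    using h[of c d] cd by (simp add: integral_unique)
  moreover have "F d = f d" "F c = f c"
    using cd by (simp_all add: F_def max_def min_def)
  ultimately have "\<bar>f d - f c\<bar> = \<bar>LINT x:{c..d}|lebesgue. h x\<bar>"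
    using set_lebesgue_integral_eq_integral(2)[OF h_abs] by simp
  also have "ennreal \<dots> \<le> (\<integral>\<^sup>+x. norm (indicator {c..d} x *\<^sub>R h x) \<partial>lebesgue)"
    using integral_norm_bound_ennreal[OF h_abs[unfolded set_integrable_def]]
    by (simp add: set_lebesgue_integral_def)
  also have "\<dots> = (\<integral>\<^sup>+x. ennreal \<bar>deriv f x\<bar> * indicator {c<..<d} x \<partial>lebesgue)"
  proof (rule nn_integral_cong_AE)
    \<comment> \<open>The endpoints join the null set to pass from the closed to the open
      interval.\<close>
    have "negligible (N \<union> {c, d})"
      using N(1) by simp
    then have "AE x in lebesgue. x \<notin> N \<union> {c, d}"
      unfolding negligible_iff_null_sets by (rule AE_not_in)
    then show "AE x in lebesgue. ennreal (norm (indicat_real {c..d} x *\<^sub>R h x)) =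
        ennreal \<bar>deriv f x\<bar> * indicator {c<..<d} x"
      by eventually_elim (auto simp: deriv split: split_indicator)
  qed
  finally show ?thesis .
qed

subsection \<open>The modular and the variation\<close>

text \<open>Comparing the quotients at \<open>\<theta> * s\<close> and \<open>s\<close> and clearing
  denominators gives the claim. It replaces the convexity estimate: a small factor inside becomes a
  small factor outside at the price of \<open>L\<close>.\<close>

lemma almost_increasing_scale:
  fixes \<psi> :: "real \<Rightarrow> ennreal"
  assumes mono: "mono_on {0..} \<psi>" and zero: "\<psi> 0 = 0"
    and inc: "\<And>s t. \<lbrakk>0 < s; s < t\<rbrakk> \<Longrightarrow> \<psi> s / ennreal s \<le> ennreal L * (\<psi> t / ennreal t)"
    and "1 \<le> L" "0 \<le> \<theta>" "\<theta> \<le> 1" "0 \<le> s"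
  shows "\<psi> (\<theta> * s) \<le> ennreal (L * \<theta>) * \<psi> s"
proof -
  \<comment> \<open>The quotient condition speaks only of \<open>0 < s < t\<close>, so zero
    arguments and \<open>\<theta> = 1\<close> are treated apart; an infinite \<open>\<psi> s\<close>
    is split off so that the last case is real arithmetic.\<close>
  consider "\<theta> * s = 0" | "0 < \<theta>" "0 < s" "\<psi> s = top" | "\<theta> = 1" "0 < s"
    | "0 < \<theta>" "\<theta> < 1" "0 < s" "\<psi> s \<noteq> top"
    using assms by fastforce
  then show ?thesis
  proof cases
    case 1
    then show ?thesis using zero by (simp only: zero_le)
  next
    case 2
    then show ?thesis using \<open>1 \<le> L\<close> by (simp add: ennreal_mult_top)
  next
    case 3
    then show ?thesis
      using mult_right_mono[of 1 "ennreal L" "\<psi> s"] \<open>1 \<le> L\<close> by simp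
  next
    case 4
    have "\<psi> (\<theta> * s) \<le> \<psi> s"
      using 4 by (intro mono_onD[OF mono]) (auto simp: mult_left_le_one_le)
    then obtain p q where pq: "\<psi> s = ennreal p" "0 \<le> p" "\<psi> (\<theta> * s) = ennreal q" "0 \<le> q"
      using 4 by (metis ennreal_cases neq_top_trans)
    have "\<psi> (\<theta> * s) / ennreal (\<theta> * s) \<le> ennreal L * (\<psi> s / ennreal s)"
      using 4 by (intro inc) auto
    then have "q / (\<theta> * s) \<le> L * (p / s)"
      using 4 pq \<open>1 \<le> L\<close> by (simp add: divide_ennreal ennreal_mult[symmetric])
    then have "q \<le> L * \<theta> * p"
      using 4 by (simp add: field_simps)
    then show ?thesis
      using pq 4 \<open>1 \<le> L\<close> by (simp add: ennreal_mult[symmetric])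
  qed
qed

text \<open>
  If \<open>\<phi>(\<cdot>,s) \<ge> m\<close> on the interval, where \<open>s = T/2\<close>, then \<open>m \<bar>g\<bar> \<le> L s \<phi>(\<cdot>,\<bar>g\<bar>) + m s\<close> pointwise, and
  integrating bounds \<open>m\<close>. Comparing with a constant avoids the measurability of the infimum of \<open>\<phi>\<close>.
\<close>

lemma almost_Jensen:
  fixes \<phi> :: "real \<Rightarrow> real \<Rightarrow> ennreal" and g :: "real \<Rightarrow> real"
  assumes "c < d" "1 \<le> L" "0 < T" "0 < e" "0 \<le> q"
    and inc: "\<And>x s t. \<lbrakk>x \<in> {c<..<d}; 0 < s; s < t\<rbrakk> \<Longrightarrow> \<phi> x s / ennreal s \<le> ennreal L * (\<phi> x t / ennreal t)"
    and meas: "(\<lambda>x. \<phi> x \<bar>g x\<bar> * indicator {c<..<d} x) \<in> borel_measurable lebesgue"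
    and q: "(\<integral>\<^sup>+x. \<phi> x \<bar>g x\<bar> * indicator {c<..<d} x \<partial>lebesgue) = ennreal q"
    and meas_g: "(\<lambda>x. ennreal \<bar>g x\<bar> * indicator {c<..<d} x) \<in> borel_measurable lebesgue"
    and T: "ennreal (T * (d - c)) \<le> (\<integral>\<^sup>+x. ennreal \<bar>g x\<bar> * indicator {c<..<d} x \<partial>lebesgue)"
  shows "\<exists>y\<in>{c<..<d}. \<phi> y (T / 2) \<le> ennreal ((L * q + e) / (d - c))"
proof (rule ccontr)
  \<comment> \<open>The summand \<open>e\<close> makes \<open>m\<close> positive and
    \<open>m * (d - c)\<close> strictly larger than \<open>L * q\<close>, the inequality that is
    contradicted at the end.\<close>
  define m where "m = (L * q + e) / (d - c)"
  define s where "s = T / 2"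
  have pos: "0 < m" "0 < s"
    using assms by (auto simp: m_def s_def add_nonneg_pos)
  assume "\<not> ?thesis"
  then have big: "ennreal m \<le> \<phi> y s" if "y \<in> {c<..<d}" for y
    using that unfolding m_def s_def by (meson linear)
  have "ennreal m * (ennreal \<bar>g x\<bar> * indicator {c<..<d} x) \<le>
      ennreal (L * s) * (\<phi> x \<bar>g x\<bar> * indicator {c<..<d} x) + ennreal (m * s) * indicator {c<..<d} x" for x
  proof (cases "x \<in> {c<..<d}")
    case True
    have "ennreal (m * \<bar>g x\<bar>) \<le> ennreal (L * s) * \<phi> x \<bar>g x\<bar> + ennreal (m * s)"
    proof (cases "\<bar>g x\<bar> \<le> s")
      case True
      then have "ennreal (m * \<bar>g x\<bar>) \<le> ennreal (m * s)"
        using pos by (intro ennreal_leI mult_left_mono) auto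
      then show ?thesis
        by (simp add: add_increasing)
    next
      case False
      show ?thesis
      proof (cases "\<phi> x \<bar>g x\<bar>")
        case (real p)
        have "ennreal (m / s) = ennreal m / ennreal s"
          using pos by (simp add: divide_ennreal)
        also have "\<dots> \<le> \<phi> x s / ennreal s"
          using big[OF True] by (rule divide_right_mono_ennreal)
        also have "\<dots> \<le> ennreal L * (\<phi> x \<bar>g x\<bar> / ennreal \<bar>g x\<bar>)"
          using False pos True by (intro inc) auto
        also have "\<dots> = ennreal (L * (p / \<bar>g x\<bar>))"
          using False pos real \<open>1 \<le> L\<close> by (simp add: divide_ennreal ennreal_mult[symmetric])
        finally have "m / s \<le> L * (p / \<bar>g x\<bar>)"
          using real \<open>1 \<le> L\<close> by (subst (asm) ennreal_le_iff) auto
        then have "m * \<bar>g x\<bar> \<le> L * s * p"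
          using pos False by (simp add: field_simps)
        then have "ennreal (m * \<bar>g x\<bar>) \<le> ennreal (L * s) * \<phi> x \<bar>g x\<bar>"
          using real pos \<open>1 \<le> L\<close> by (simp add: ennreal_mult[symmetric] ennreal_leI)
        then show ?thesis
          by (simp add: add_increasing2)
      next
        case top
        then show ?thesis
          using pos \<open>1 \<le> L\<close> by (simp add: ennreal_mult_top)
      qed
    qed
    then show ?thesis
      using True pos by (simp add: ennreal_mult)
  qed simp
  then have "(\<integral>\<^sup>+x. ennreal m * (ennreal \<bar>g x\<bar> * indicator {c<..<d} x) \<partial>lebesgue) \<le>
      (\<integral>\<^sup>+x. ennreal (L * s) * (\<phi> x \<bar>g x\<bar> * indicator {c<..<d} x) + ennreal (m * s) * indicator {c<..<d} x \<partial>lebesgue)"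
    by (intro nn_integral_mono)
  also have "\<dots> = ennreal (L * s) * ennreal q + ennreal (m * s) * ennreal (d - c)"
    using meas \<open>c < d\<close>
    by (subst nn_integral_add) (auto simp: nn_integral_cmult q nn_integral_cmult_indicator
        intro!: borel_measurable_times_ennreal borel_measurable_indicator)
  also have "\<dots> = ennreal (L * s * q + m * s * (d - c))"
    using assms pos by (simp add: ennreal_mult ennreal_plus)
  finally have "ennreal m * (\<integral>\<^sup>+x. ennreal \<bar>g x\<bar> * indicator {c<..<d} x \<partial>lebesgue) \<le> ennreal (L * s * q + m * s * (d - c))"
    using meas_g by (simp add: nn_integral_cmult)
  then have "ennreal m * ennreal (T * (d - c)) \<le> ennreal (L * s * q + m * s * (d - c))"
    using mult_left_mono[OF T, of "ennreal m"] by (meson order_trans zero_le)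
  then have "ennreal (m * (T * (d - c))) \<le> ennreal (L * s * q + m * s * (d - c))"
    using assms pos by (subst ennreal_mult) auto
  then have "m * (T * (d - c)) \<le> L * s * q + m * s * (d - c)"
    by (subst (asm) ennreal_le_iff) (use assms pos in auto)
  \<comment> \<open>Halving \<open>T\<close> pays off here: the term \<open>m * s * (d - c)\<close>
    from points with small \<open>g\<close> absorbs only half of the left-hand side.\<close>
  moreover have "T = 2 * s"
    by (simp add: s_def)
  ultimately have "s * (m * (d - c)) \<le> s * (L * q)"
    by (simp add: algebra_simps)
  then have "m * (d - c) \<le> L * q"
    using pos by simp
  then show False
    using \<open>0 < e\<close> \<open>c < d\<close> by (simp add: m_def)
qed

section \<open>Estimates for the variation over partitions\<close>

lemma borel_measurable_lebesgue_times_indicator: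
  fixes h :: "real \<Rightarrow> ennreal"
  assumes "h \<in> borel_measurable (lebesgue_on {a..b})" "S \<in> sets lebesgue" "S \<subseteq> {a..b}"
  shows "(\<lambda>x. h x * indicator S x) \<in> borel_measurable lebesgue"
proof -
  have "(\<lambda>x. h x * indicator {a..b} x) \<in> borel_measurable lebesgue"
    using assms(1) by (subst borel_measurable_restrict_space_iff_ennreal[symmetric]) auto
  then have "(\<lambda>x. h x * indicator {a..b} x * indicator S x) \<in> borel_measurable lebesgue"
    using assms(2) by measurable
  moreover have "h x * indicator {a..b} x * indicator S x = h x * indicator S x" for x
    using assms(3) by (auto split: split_indicator)
  ultimately show ?thesis
    by simp
qed

lemma partition_of_member:
  assumes "P partition_of {a..b::real}" "J \<in> P"
  obtains c d where "J = {c..d}" "c < d" "a \<le> c" "d \<le> b" "Inf J = c" "Sup J = d" "measure lebesgue J = d - c"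
proof -
  have P: "P division_of {a..b}" "Inf J < Sup J"
    using assms by (auto simp: partition_of_def)
  obtain c d where J: "J = {c..d}"
    using division_ofD(4)[OF P(1) assms(2)] by auto
  have "J \<noteq> {}" "J \<subseteq> {a..b}"
    using division_ofD(2,3)[OF P(1) assms(2)] by auto
  with J have "c \<le> d" "a \<le> c" "d \<le> b" by auto
  with that P J show thesis by auto
qed

text \<open>\<open>almost_increasing_scale\<close> applies at each point with the same
  \<open>L\<close>, so it survives the supremum over a member and the sum over the
  partition.\<close>

lemma Var_phi_scale:
  fixes a b :: real
  assumes mono: "\<And>x. x \<in> {a..b} \<Longrightarrow> mono_on {0..} (\<phi> x)" and zero: "\<And>x. x \<in> {a..b} \<Longrightarrow> \<phi> x 0 = 0"
    and inc: "\<And>x s t. \<lbrakk>x \<in> {a..b}; 0 < s; s < t\<rbrakk> \<Longrightarrow> \<phi> x s / ennreal s \<le> ennreal L * (\<phi> x t / ennreal t)"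
    and "1 \<le> L" "\<bar>\<theta>\<bar> \<le> 1"
  shows "Var_phi {a..b} \<phi> (\<lambda>x. \<theta> * f x) \<le> ennreal (L * \<bar>\<theta>\<bar>) * Var_phi {a..b} \<phi> f"
  unfolding Var_phi_def[of _ _ "\<lambda>x. \<theta> * f x"]
proof (rule SUP_least)
  fix P assume "P \<in> {P. P partition_of {a..b}}"
  then have P: "P partition_of {a..b}" by simp
  have "phi_plus \<phi> J (\<bar>Delta (\<lambda>x. \<theta> * f x) J\<bar> / measure lebesgue J)
      \<le> ennreal (L * \<bar>\<theta>\<bar>) * phi_plus \<phi> J (\<bar>Delta f J\<bar> / measure lebesgue J)" if "J \<in> P" for J
    unfolding phi_plus_def
  proof (rule SUP_least)
    fix x assume "x \<in> J"
    then have x: "x \<in> {a..b}"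
      using P that division_ofD(2) unfolding partition_of_def by blast
    have "\<phi> x (\<bar>Delta (\<lambda>x. \<theta> * f x) J\<bar> / measure lebesgue J) = \<phi> x (\<bar>\<theta>\<bar> * (\<bar>Delta f J\<bar> / measure lebesgue J))"
      by (simp add: Delta_def abs_mult flip: right_diff_distrib)
    also have "\<dots> \<le> ennreal (L * \<bar>\<theta>\<bar>) * \<phi> x (\<bar>Delta f J\<bar> / measure lebesgue J)"
      by (rule almost_increasing_scale[OF mono[OF x] zero[OF x] inc[OF x]]) (use assms(4,5) in auto)
    also have "\<dots> \<le> ennreal (L * \<bar>\<theta>\<bar>) * (SUP x\<in>J. \<phi> x (\<bar>Delta f J\<bar> / measure lebesgue J))"
      using \<open>x \<in> J\<close> by (intro mult_left_mono SUP_upper) auto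
    finally show "\<phi> x (\<bar>Delta (\<lambda>x. \<theta> * f x) J\<bar> / measure lebesgue J)
        \<le> ennreal (L * \<bar>\<theta>\<bar>) * (SUP x\<in>J. \<phi> x (\<bar>Delta f J\<bar> / measure lebesgue J))" .
  qed
  then have "(\<Sum>J\<in>P. phi_plus \<phi> J (\<bar>Delta (\<lambda>x. \<theta> * f x) J\<bar> / measure lebesgue J) * ennreal (measure lebesgue J))
      \<le> (\<Sum>J\<in>P. ennreal (L * \<bar>\<theta>\<bar>) * (phi_plus \<phi> J (\<bar>Delta f J\<bar> / measure lebesgue J) * ennreal (measure lebesgue J)))"
    by (intro sum_mono) (metis mult.assoc mult_right_mono zero_le)
  also have "\<dots> = ennreal (L * \<bar>\<theta>\<bar>) * (\<Sum>J\<in>P. phi_plus \<phi> J (\<bar>Delta f J\<bar> / measure lebesgue J) * ennreal (measure lebesgue J))"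
    by (simp add: sum_distrib_left)
  also have "\<dots> \<le> ennreal (L * \<bar>\<theta>\<bar>) * Var_phi {a..b} \<phi> f"
    unfolding Var_phi_def using P by (intro mult_left_mono SUP_upper) auto
  finally show "(\<Sum>J\<in>P. phi_plus \<phi> J (\<bar>Delta (\<lambda>x. \<theta> * f x) J\<bar> / measure lebesgue J) * ennreal (measure lebesgue J))
      \<le> ennreal (L * \<bar>\<theta>\<bar>) * Var_phi {a..b} \<phi> f" .
qed

text \<open>The derivative enters only through \<open>incr\<close>, so the lemma can be applied to
  multiples of \<open>f\<close> and \<open>f'\<close>. The constant \<open>2 * (L + 1)\<close> in
  \<open>A1\<close> matches the bound \<open>(L + 1) / (d - c)\<close> from
  \<open>almost_Jensen\<close> with a ball of measure \<open>2 * (d - c)\<close>.\<close>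

lemma Var_phi_le:
  fixes a b :: real
  assumes "a < b" "1 \<le> L" "0 < \<beta>"
    and zero: "\<And>x. x \<in> {a..b} \<Longrightarrow> \<phi> x 0 = 0"
    and inc: "\<And>x s t. \<lbrakk>x \<in> {a..b}; 0 < s; s < t\<rbrakk> \<Longrightarrow> \<phi> x s / ennreal s \<le> ennreal L * (\<phi> x t / ennreal t)"
    and A1: "\<And>z r x y t. \<lbrakk>0 < r; x \<in> ball z r \<inter> {a..b}; y \<in> ball z r \<inter> {a..b}; 0 \<le> t;
        \<phi> y t \<le> ennreal (2 * (L + 1) / measure lebesgue (ball z r))\<rbrakk> \<Longrightarrow> \<phi> x (\<beta> * t) \<le> \<phi> y t + 1"
    and g: "g \<in> borel_measurable (lebesgue_on {a..b})"
    and meas: "(\<lambda>x. \<phi> x \<bar>g x\<bar>) \<in> borel_measurable (lebesgue_on {a..b})"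
    and mod: "modular {a..b} \<phi> g \<le> 1"
    and incr: "\<And>c d. \<lbrakk>a \<le> c; c < d; d \<le> b\<rbrakk> \<Longrightarrow>
        ennreal \<bar>f d - f c\<bar> \<le> (\<integral>\<^sup>+x. ennreal \<bar>g x\<bar> * indicator {c<..<d} x \<partial>lebesgue)"
  shows "Var_phi {a..b} \<phi> (\<lambda>x. \<beta> / 2 * f x) \<le> ennreal (L + 2 * (b - a))"
proof -
  have mod': "modular {a..b} \<phi> g = (\<integral>\<^sup>+x. \<phi> x \<bar>g x\<bar> * indicator {a..b} x \<partial>lebesgue)"
    unfolding modular_def by (rule nn_integral_restrict_space) simp
  have meas': "(\<lambda>x. \<phi> x \<bar>g x\<bar> * indicator S x) \<in> borel_measurable lebesgue"
    and meas_g: "(\<lambda>x. ennreal \<bar>g x\<bar> * indicator S x) \<in> borel_measurable lebesgue"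
    if S: "S \<in> sets lebesgue" "S \<subseteq> {a..b}" for S
  proof -
    show "(\<lambda>x. \<phi> x \<bar>g x\<bar> * indicator S x) \<in> borel_measurable lebesgue"
      by (rule borel_measurable_lebesgue_times_indicator[OF meas S])
    have "(\<lambda>x. ennreal \<bar>g x\<bar>) \<in> borel_measurable (lebesgue_on {a..b})"
      using g by measurable
    then show "(\<lambda>x. ennreal \<bar>g x\<bar> * indicator S x) \<in> borel_measurable lebesgue"
      by (rule borel_measurable_lebesgue_times_indicator[OF _ S])
  qed
  define Q where "Q S = (\<integral>\<^sup>+x. \<phi> x \<bar>g x\<bar> * indicator S x \<partial>lebesgue)" for S
  have Q_le: "Q S \<le> 1" if "S \<subseteq> {a..b}" for S
  proof -
    have "Q S \<le> modular {a..b} \<phi> g"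
      unfolding Q_def mod' using that by (intro nn_integral_mono mult_left_mono) (auto split: split_indicator)
    then show ?thesis using mod by simp
  qed
  have local_est: "\<phi> x (\<beta> / 2 * (\<bar>f d - f c\<bar> / (d - c))) * ennreal (d - c) \<le> ennreal L * Q {c<..<d} + ennreal (2 * (d - c))"
    if cd: "a \<le> c" "c < d" "d \<le> b" and x: "x \<in> {c..d}" for c d x
  proof (cases "f d = f c")
    case True
    then show ?thesis using zero[of x] x cd by simp
  next
    case False
    define T where "T = \<bar>f d - f c\<bar> / (d - c)"
    have "T > 0"
      using False cd by (simp add: T_def)
    have Q1: "Q {c<..<d} \<le> 1"
      using cd by (intro Q_le) auto
    then obtain q where q: "Q {c<..<d} = ennreal q" "0 \<le> q"
      by (metis ennreal_cases ennreal_one_neq_top neq_top_trans)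
    with Q1 have "q \<le> 1" by simp
    \<comment> \<open>The error is at most 1, to stay below the threshold of \<open>A1\<close>, and
      at most \<open>d - c\<close>, so that the errors add up to at most \<open>b - a\<close> over
      the partition.\<close>
    let ?e = "min 1 (d - c)"
    have "\<exists>y\<in>{c<..<d}. \<phi> y (T / 2) \<le> ennreal ((L * q + ?e) / (d - c))"
    proof (rule almost_Jensen)
      show "(\<integral>\<^sup>+x. \<phi> x \<bar>g x\<bar> * indicator {c<..<d} x \<partial>lebesgue) = ennreal q"
        using q by (simp add: Q_def)
      show "ennreal (T * (d - c)) \<le> (\<integral>\<^sup>+x. ennreal \<bar>g x\<bar> * indicator {c<..<d} x \<partial>lebesgue)"
        using incr[of c d] cd by (simp add: T_def)
      show "(\<lambda>x. \<phi> x \<bar>g x\<bar> * indicator {c<..<d} x) \<in> borel_measurable lebesgue"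
        "(\<lambda>x. ennreal \<bar>g x\<bar> * indicator {c<..<d} x) \<in> borel_measurable lebesgue"
        using cd by (auto intro!: meas' meas_g)
      show "\<phi> x s / ennreal s \<le> ennreal L * (\<phi> x t / ennreal t)"
        if "x \<in> {c<..<d}" "0 < s" "s < t" for x s t
        using that cd by (intro inc) auto
    qed (use cd q \<open>T > 0\<close> \<open>1 \<le> L\<close> in auto)
    then obtain y where y: "y \<in> {c<..<d}" "\<phi> y (T / 2) \<le> ennreal ((L * q + ?e) / (d - c))"
      by blast
    have "\<phi> x (\<beta> * (T / 2)) \<le> \<phi> y (T / 2) + 1"
    proof (rule A1)
      show "0 < d - c" "0 \<le> T / 2"
        using cd \<open>T > 0\<close> by auto
      \<comment> \<open>The radius is the full length of the interval, so the open ball also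
        contains the endpoints, which \<open>x\<close> may be.\<close>
      show "x \<in> ball ((c + d) / 2) (d - c) \<inter> {a..b}" "y \<in> ball ((c + d) / 2) (d - c) \<inter> {a..b}"
        using x y cd by (auto simp: dist_real_def abs_if field_simps)
      have "L * q + ?e \<le> L + 1"
        using \<open>1 \<le> L\<close> \<open>q \<le> 1\<close> mult_left_le[of q L] by linarith
      then have "(L * q + ?e) / (d - c) \<le> 2 * (L + 1) / (2 * (d - c))"
        using cd divide_right_mono[of "L * q + ?e" "L + 1" "d - c"] by (simp only: mult_divide_mult_cancel_left)
      also have "2 * (d - c) = measure lebesgue (ball ((c + d) / 2) (d - c))"
        using cd by (simp add: ball_eq_greaterThanLessThan)
      finally show "\<phi> y (T / 2) \<le> ennreal (2 * (L + 1) / measure lebesgue (ball ((c + d) / 2) (d - c)))"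
        using y(2) ennreal_leI order_trans by blast
    qed
    also have "\<dots> \<le> ennreal ((L * q + ?e) / (d - c)) + ennreal 1"
      using y(2) by (simp add: add_right_mono)
    also have "\<dots> = ennreal ((L * q + ?e) / (d - c) + 1)"
      using cd q \<open>1 \<le> L\<close> by (intro ennreal_plus[symmetric]) auto
    finally have "\<phi> x (\<beta> / 2 * T) * ennreal (d - c) \<le> ennreal ((L * q + ?e) / (d - c) + 1) * ennreal (d - c)"
      by (intro mult_right_mono) (simp_all add: mult.commute)
    also have "\<dots> = ennreal (((L * q + ?e) / (d - c) + 1) * (d - c))"
      using cd q \<open>1 \<le> L\<close> by (intro ennreal_mult[symmetric]) (auto intro!: add_nonneg_nonneg divide_nonneg_nonneg)
    also have "((L * q + ?e) / (d - c) + 1) * (d - c) = L * q + ?e + (d - c)"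
    proof -
      have "(X / y + 1) * y = X + y" if "y \<noteq> 0" for X y :: real
        using that by (simp add: field_simps)
      then show ?thesis using cd by simp
    qed
    also have "ennreal \<dots> \<le> ennreal (L * q + 2 * (d - c))"
      by (intro ennreal_leI) auto
    also have "\<dots> = ennreal L * Q {c<..<d} + ennreal (2 * (d - c))"
      using q cd \<open>1 \<le> L\<close> by (simp add: ennreal_plus ennreal_mult)
    finally show ?thesis
      unfolding T_def .
  qed
  show ?thesis
    unfolding Var_phi_def
  proof (rule SUP_least)
    fix P assume "P \<in> {P. P partition_of {a..b}}"
    then have P: "P partition_of {a..b}" and div: "P division_of {a..b}"
      by (auto simp: partition_of_def)
    note fin = division_ofD(1)[OF div]
    have disj: "disjoint_family_on interior P"
      using division_ofD(5)[OF div] by (auto simp: disjoint_family_on_def)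
    have sub: "interior J \<subseteq> {a..b}" if "J \<in> P" for J
      using division_ofD(2)[OF div that] interior_subset by blast
    have "(\<Sum>J\<in>P. phi_plus \<phi> J (\<bar>Delta (\<lambda>x. \<beta> / 2 * f x) J\<bar> / measure lebesgue J) * ennreal (measure lebesgue J))
        \<le> (\<Sum>J\<in>P. ennreal L * Q (interior J) + ennreal (2 * measure lebesgue J))"
    proof (rule sum_mono)
      fix J assume "J \<in> P"
      then obtain c d where J: "J = {c..d}" "c < d" "a \<le> c" "d \<le> b" "Inf J = c" "Sup J = d" "measure lebesgue J = d - c"
        using partition_of_member[OF P] by blast
      have "\<bar>Delta (\<lambda>x. \<beta> / 2 * f x) J\<bar> = \<beta> / 2 * \<bar>f d - f c\<bar>"
        using J \<open>0 < \<beta>\<close> unfolding Delta_def by (simp add: abs_minus_commute abs_mult flip: right_diff_distrib diff_divide_distrib)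
      then have eq: "\<bar>Delta (\<lambda>x. \<beta> / 2 * f x) J\<bar> / measure lebesgue J = \<beta> / 2 * (\<bar>f d - f c\<bar> / (d - c))"
        by (simp only: J(7) times_divide_eq_right)
      show "phi_plus \<phi> J (\<bar>Delta (\<lambda>x. \<beta> / 2 * f x) J\<bar> / measure lebesgue J) * ennreal (measure lebesgue J)
          \<le> ennreal L * Q (interior J) + ennreal (2 * measure lebesgue J)"
        unfolding phi_plus_def eq SUP_mult_right_ennreal
      proof (rule SUP_least)
        fix x assume "x \<in> J"
        then show "\<phi> x (\<beta> / 2 * (\<bar>f d - f c\<bar> / (d - c))) * ennreal (measure lebesgue J)
            \<le> ennreal L * Q (interior J) + ennreal (2 * measure lebesgue J)"
          using local_est[of c d x] J by simp
      qed
    qed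
    also have "\<dots> = ennreal L * (\<Sum>J\<in>P. Q (interior J)) + ennreal (2 * (\<Sum>J\<in>P. measure lebesgue J))"
      by (simp add: sum.distrib sum_distrib_left sum_ennreal)
    also have "(\<Sum>J\<in>P. measure lebesgue J) = b - a"
    proof -
      have "(\<Sum>J\<in>P. measure lebesgue J) = (\<Sum>J\<in>P. measure lborel J)"
      proof (rule sum.cong)
        fix J assume "J \<in> P"
        then obtain c d where "J = {c..d}"
          using partition_of_member[OF P] by metis
        then show "measure lebesgue J = measure lborel J"
          by (simp add: measure_completion)
      qed simp
      then show ?thesis
        using additive_content_division[of P a b] div \<open>a < b\<close> by simp
    qed
    \<comment> \<open>Neighbouring members share endpoints, but their interiors are disjoint, so the
      local integrals add up to one over a subset of \<open>{a..b}\<close>.\<close>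
    also have "(\<Sum>J\<in>P. Q (interior J)) \<le> 1"
    proof -
      have "(\<Sum>J\<in>P. Q (interior J)) = (\<integral>\<^sup>+x. (\<Sum>J\<in>P. \<phi> x \<bar>g x\<bar> * indicator (interior J) x) \<partial>lebesgue)"
        unfolding Q_def using sub by (intro nn_integral_sum[symmetric] meas') auto
      also have "\<dots> = Q (\<Union>(interior ` P))"
        unfolding Q_def indicator_UN_disjoint[OF fin disj] by (simp add: sum_distrib_left)
      also have "\<dots> \<le> 1"
        using sub by (intro Q_le) auto
      finally show ?thesis .
    qed
    then have "ennreal L * (\<Sum>J\<in>P. Q (interior J)) + ennreal (2 * (b - a)) \<le> ennreal L + ennreal (2 * (b - a))"
      by (intro add_right_mono) (metis mult.right_neutral mult_left_mono zero_le)
    also have "\<dots> = ennreal (L + 2 * (b - a))"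
      using \<open>1 \<le> L\<close> \<open>a < b\<close> by (simp add: ennreal_plus)
    finally show "(\<Sum>J\<in>P. phi_plus \<phi> J (\<bar>Delta (\<lambda>x. \<beta> / 2 * f x) J\<bar> / measure lebesgue J) * ennreal (measure lebesgue J))
        \<le> ennreal (L + 2 * (b - a))" .
  qed
qed

section \<open>The constant and the norm inequality\<close>

theorem theorem6p1:
  fixes a b :: real and \<phi> :: "real \<Rightarrow> real \<Rightarrow> ennreal"
  assumes "a < b"
    and "\<phi> \<in> Phi_w {a..b}"
    and "A0 {a..b} \<phi>"
    and "A1 {a..b} \<phi>"
  shows "\<exists>c::real. c > 0 \<and>
    (\<forall>f::real \<Rightarrow> real. abs_continuous_on {a..b} f \<and> deriv f \<in> L_phi {a..b} \<phi> \<longrightarrow>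
       f \<in> RBV {a..b} \<phi> \<and>
       RBV_norm {a..b} \<phi> f \<le> ennreal c * L_phi_norm {a..b} \<phi> (deriv f))"
proof -
  have meas: "(\<lambda>x. \<phi> x \<bar>g x\<bar>) \<in> borel_measurable (lebesgue_on {a..b})"
    if "g \<in> borel_measurable (lebesgue_on {a..b})" for g
    using assms(2) that unfolding Phi_w_def by blast
  have mono: "mono_on {0..} (\<phi> x)" and zero: "\<phi> x 0 = 0" if "x \<in> {a..b}" for x
    using assms(2) that unfolding Phi_w_def by blast+
  obtain L :: real where "1 \<le> L"
    and inc: "\<And>x s t. \<lbrakk>x \<in> {a..b}; 0 < s; s < t\<rbrakk> \<Longrightarrow> \<phi> x s / ennreal s \<le> ennreal L * (\<phi> x t / ennreal t)"
    using assms(2) unfolding Phi_w_def by blast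
  have "2 * (L + 1) > 0"
    using \<open>1 \<le> L\<close> by simp
  with assms(4) obtain \<beta> where "0 < \<beta>" "\<beta> \<le> 1"
    and \<beta>: "\<forall>z r. r > 0 \<longrightarrow> (\<forall>x \<in> ball z r \<inter> {a..b}. \<forall>y \<in> ball z r \<inter> {a..b}. \<forall>t\<ge>0.
      \<phi> y t \<le> ennreal (2 * (L + 1) / measure lebesgue (ball z r)) \<longrightarrow> \<phi> x (\<beta> * t) \<le> \<phi> y t + 1)"
    unfolding A1_def by meson
  have A1: "\<And>z r x y t. \<lbrakk>0 < r; x \<in> ball z r \<inter> {a..b}; y \<in> ball z r \<inter> {a..b}; 0 \<le> t;
        \<phi> y t \<le> ennreal (2 * (L + 1) / measure lebesgue (ball z r))\<rbrakk> \<Longrightarrow> \<phi> x (\<beta> * t) \<le> \<phi> y t + 1"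
    for z r x y t
    by (rule \<beta>[rule_format])
  define C where "C = L + 2 * (b - a)"
  \<comment> \<open>Chosen so that \<open>f / (c * l)\<close> equals \<open>f / l\<close> times
    \<open>\<beta> / 2\<close>, for the variation bound \<open>C\<close>, and times
    \<open>1 / (L * C)\<close>, which brings that bound down to 1.\<close>
  define c where "c = 2 * L * C / \<beta>"
  have "1 \<le> C"
    using \<open>1 \<le> L\<close> \<open>a < b\<close> by (simp add: C_def)
  \<comment> \<open>This makes \<open>1 / (L * C)\<close> admissible as a scaling factor
    \<open>\<theta>\<close>.\<close>
  then have "1 \<le> L * C"
    using \<open>1 \<le> L\<close> mult_mono[of 1 L 1 C] by simp
  have "c > 0"
    unfolding c_def using \<open>1 \<le> L\<close> \<open>1 \<le> C\<close> \<open>0 < \<beta>\<close> by (intro divide_pos_pos mult_pos_pos) auto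
  \<comment> \<open>Here \<open>k\<close> normalises the modular of the derivative, and
    \<open>\<theta>\<close> scales the resulting bound linearly. The same estimate serves membership
    (\<open>\<theta>\<close> tending to 0) and the norm (\<open>\<theta>\<close> fixed).\<close>
  have Var_small: "Var_phi {a..b} \<phi> (\<lambda>x. \<theta> * (\<beta> / 2 * (k * f x))) \<le> ennreal (L * \<bar>\<theta>\<bar> * C)"
    if ac: "abs_continuous_on {a..b} f" and f': "deriv f \<in> L_phi {a..b} \<phi>"
      and "0 < k" and mod: "modular {a..b} \<phi> (\<lambda>x. k * deriv f x) \<le> 1" and "\<bar>\<theta>\<bar> \<le> 1" for f k \<theta>
  proof -
    have "deriv f \<in> borel_measurable (lebesgue_on {a..b})"
      using f' by (simp add: L_phi_def)
    then have g: "(\<lambda>x. k * deriv f x) \<in> borel_measurable (lebesgue_on {a..b})"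
      by measurable
    have ab: "Var_phi {a..b} \<phi> (\<lambda>x. \<beta> / 2 * (k * f x)) \<le> ennreal (L + 2 * (b - a))"
    proof (rule Var_phi_le[OF \<open>a < b\<close> \<open>1 \<le> L\<close> \<open>0 < \<beta>\<close> zero inc A1 g meas[OF g] mod])
      fix c d assume cd: "a \<le> c" "c < d" "d \<le> b"
      have "ennreal \<bar>k * f d - k * f c\<bar> = ennreal k * ennreal \<bar>f d - f c\<bar>"
        using \<open>0 < k\<close> by (simp add: abs_mult ennreal_mult flip: right_diff_distrib)
      also have "\<dots> \<le> ennreal k * (\<integral>\<^sup>+x. ennreal \<bar>deriv f x\<bar> * indicator {c<..<d} x \<partial>lebesgue)"
        using abs_continuous_on_increment_le_integral_deriv[OF \<open>a < b\<close> ac cd] by (rule mult_left_mono) simp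
      also have "\<dots> = (\<integral>\<^sup>+x. ennreal k * (ennreal \<bar>deriv f x\<bar> * indicator {c<..<d} x) \<partial>lebesgue)"
      proof (rule nn_integral_cmult[symmetric])
        have "(\<lambda>x. ennreal \<bar>deriv f x\<bar>) \<in> borel_measurable (lebesgue_on {a..b})"
          using \<open>deriv f \<in> borel_measurable (lebesgue_on {a..b})\<close> by measurable
        then show "(\<lambda>x. ennreal \<bar>deriv f x\<bar> * indicator {c<..<d} x) \<in> borel_measurable lebesgue"
          using cd by (intro borel_measurable_lebesgue_times_indicator) auto
      qed
      also have "\<dots> = (\<integral>\<^sup>+x. ennreal \<bar>k * deriv f x\<bar> * indicator {c<..<d} x \<partial>lebesgue)"
        using \<open>0 < k\<close> by (simp add: abs_mult ennreal_mult mult.assoc)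
      finally show "ennreal \<bar>k * f d - k * f c\<bar> \<le> (\<integral>\<^sup>+x. ennreal \<bar>k * deriv f x\<bar> * indicator {c<..<d} x \<partial>lebesgue)" .
    qed
    have "Var_phi {a..b} \<phi> (\<lambda>x. \<theta> * (\<beta> / 2 * (k * f x))) \<le>
        ennreal (L * \<bar>\<theta>\<bar>) * Var_phi {a..b} \<phi> (\<lambda>x. \<beta> / 2 * (k * f x))"
      by (rule Var_phi_scale[OF mono zero inc \<open>1 \<le> L\<close> \<open>\<bar>\<theta>\<bar> \<le> 1\<close>])
    also have "\<dots> \<le> ennreal (L * \<bar>\<theta>\<bar>) * ennreal C"
      using ab unfolding C_def by (rule mult_left_mono) simp
    also have "\<dots> = ennreal (L * \<bar>\<theta>\<bar> * C)"
      using \<open>1 \<le> L\<close> \<open>1 \<le> C\<close> by (intro ennreal_mult[symmetric]) auto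
    finally show ?thesis .
  qed
  have "f \<in> RBV {a..b} \<phi> \<and> RBV_norm {a..b} \<phi> f \<le> ennreal c * L_phi_norm {a..b} \<phi> (deriv f)"
    if ac: "abs_continuous_on {a..b} f" and f': "deriv f \<in> L_phi {a..b} \<phi>" for f
  proof
    have "((\<lambda>l. modular {a..b} \<phi> (\<lambda>x. l * deriv f x)) \<longlongrightarrow> 0) (at_right 0)"
      using f' by (simp add: L_phi_def)
    then have "eventually (\<lambda>l. modular {a..b} \<phi> (\<lambda>x. l * deriv f x) < 1) (at_right 0)"
      by (rule order_tendstoD) simp
    then have "eventually (\<lambda>l. l > 0 \<and> modular {a..b} \<phi> (\<lambda>x. l * deriv f x) < 1) (at_right 0)"
      using eventually_at_right_less[of 0] by eventually_elim simp
    then obtain k where k: "k > 0" "modular {a..b} \<phi> (\<lambda>x. k * deriv f x) < 1"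
      using eventually_happens[of _ "at_right (0::real)"] by auto
    \<comment> \<open>With this \<open>s\<close>, the function \<open>l * f\<close> is
      \<open>l / s\<close> times the function estimated in \<open>Var_small\<close>. Its variation
      is thus at most a constant times the absolute value of \<open>l\<close> near 0.\<close>
    define s where "s = \<beta> / 2 * k"
    have "s > 0"
      using k \<open>0 < \<beta>\<close> by (simp add: s_def)
    have le: "Var_phi {a..b} \<phi> (\<lambda>x. l * f x) \<le> ennreal (L * (\<bar>l\<bar> / s) * C)" if "\<bar>l\<bar> < s" for l
    proof -
      have "Var_phi {a..b} \<phi> (\<lambda>x. l / s * (\<beta> / 2 * (k * f x))) \<le> ennreal (L * \<bar>l / s\<bar> * C)"
        using that \<open>s > 0\<close> k by (intro Var_small[OF ac f']) auto
      moreover have "l / s * (\<beta> / 2 * (k * f x)) = l * f x" for x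
        using \<open>0 < \<beta>\<close> k(1) by (simp add: s_def field_simps)
      ultimately show ?thesis
        using \<open>s > 0\<close> by simp
    qed
    have "((\<lambda>l. Var_phi {a..b} \<phi> (\<lambda>x. l * f x)) \<longlongrightarrow> 0) (at 0)"
    proof (rule tendsto_sandwich[OF _ _ tendsto_const])
      show "eventually (\<lambda>l. Var_phi {a..b} \<phi> (\<lambda>x. l * f x) \<le> ennreal (L * (\<bar>l\<bar> / s) * C)) (at 0)"
        using \<open>s > 0\<close> le by (auto simp: eventually_at dist_real_def intro!: exI[of _ s])
      have "((\<lambda>l. L * (\<bar>l\<bar> / s) * C) \<longlongrightarrow> L * (\<bar>0\<bar> / s) * C) (at 0)"
        using \<open>s > 0\<close> by (intro tendsto_intros) auto
      then show "((\<lambda>l. ennreal (L * (\<bar>l\<bar> / s) * C)) \<longlongrightarrow> 0) (at 0)"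
        using tendsto_ennrealI[where x = 0] by simp
    qed simp
    then show "f \<in> RBV {a..b} \<phi>"
      by (simp add: RBV_def)
    have "RBV_norm {a..b} \<phi> f \<le> ennreal c * ennreal l"
      if "l > 0" "modular {a..b} \<phi> (\<lambda>x. deriv f x / l) \<le> 1" for l
    proof -
      have "Var_phi {a..b} \<phi> (\<lambda>x. 1 / (L * C) * (\<beta> / 2 * (1 / l * f x))) \<le> ennreal (L * \<bar>1 / (L * C)\<bar> * C)"
        using that \<open>1 \<le> L * C\<close> by (intro Var_small[OF ac f']) auto
      moreover have "1 / (L * C) * (\<beta> / 2 * (1 / l * f x)) = f x / (c * l)" for x
        by (simp add: c_def field_simps)
      moreover have "L * \<bar>1 / (L * C)\<bar> * C = 1"
        using \<open>1 \<le> L\<close> \<open>1 \<le> C\<close> by (simp add: abs_mult)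
      ultimately have "Var_phi {a..b} \<phi> (\<lambda>x. f x / (c * l)) \<le> 1"
        by simp
      then have "RBV_norm {a..b} \<phi> f \<le> ennreal (c * l)"
        unfolding RBV_norm_def using that \<open>c > 0\<close> by (intro INF_lower) auto
      then show ?thesis
        using that \<open>c > 0\<close> by (simp add: ennreal_mult)
    qed
    \<comment> \<open>Moving \<open>c\<close> to the left lets the bound for each admissible
      \<open>l\<close> pass to the infimum; multiplying back is valid because \<open>c\<close> is
      positive and finite.\<close>
    then have "RBV_norm {a..b} \<phi> f / ennreal c \<le> L_phi_norm {a..b} \<phi> (deriv f)"
      unfolding L_phi_norm_def using \<open>c > 0\<close>
      by (intro INF_greatest divide_le_posI_ennreal) auto
    then have "ennreal c * (RBV_norm {a..b} \<phi> f / ennreal c) \<le> ennreal c * L_phi_norm {a..b} \<phi> (deriv f)"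
      by (rule mult_left_mono) simp
    moreover have "ennreal c * (RBV_norm {a..b} \<phi> f / ennreal c) = RBV_norm {a..b} \<phi> f"
      using \<open>c > 0\<close> mult_divide_eq_ennreal[of "ennreal c" "RBV_norm {a..b} \<phi> f"]
      by (simp add: ennreal_times_divide mult.commute)
    ultimately show "RBV_norm {a..b} \<phi> f \<le> ennreal c * L_phi_norm {a..b} \<phi> (deriv f)"
      by simp
  qed
  with \<open>c > 0\<close> show ?thesis
    by blast
qed

end
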